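(* Let ${\mathscr X}=(0,1]$ with the dyadic partitions $\alpha_m=\{A_\varepsilon:\varepsilon\in{\mathscr E}_m\}$, $m\ge0$, and let $\{\beta_\varepsilon:\varepsilon\in{\mathscr E},\varepsilon\neq\emptyset\}\subset(0,\infty)$ be given, with associated Pólya tree histogram distributions $\Pi_{\alpha_m}$. Equip $M^1((0,1])$ with the tight topology. Then there exists a unique Radon probability measure on $M^1((0,1])$ projecting to $\Pi_{\alpha_m}$ for all $m\ge0$ if and only if, for every $\varepsilon\in{\mathscr E}$, $$\prod_{m\ge0}\frac{\beta_{\varepsilon0^m0}}{\beta_{\varepsilon0^m0}+\beta_{\varepsilon0^m1}}=0,$$ where $0^m$ denotes the string of $m$ zeros.
   Context: ${\mathscr E}_m$ is the set of binary strings of length $m$ (${\mathscr E}_0$ contains only the empty string), ${\mathscr E}=\bigcup_m{\mathscr E}_m$, and $\varepsilon\varepsilon'$ denotes concatenation. For $\varepsilon\in{\mathscr E}_m$ identified with integer $k-1$ written in binary ($0\le k-1<2^m$), $A_\varepsilon=((k-1)2^{-m},k2^{-m}]$, so $A_\varepsilon=A_{\varepsilon0}\cup A_{\varepsilon1}$ with $A_{\varepsilon0}$ the left half. Pólya tree histograms: let $V_{\varepsilon0}$, $\varepsilon\in{\mathscr E}$, be independent with $V_{\varepsilon0}\sim\mathrm{Beta}(\beta_{\varepsilon0},\beta_{\varepsilon1})$ and $V_{\varepsilon1}=1-V_{\varepsilon0}$; for $\varepsilon=e_1\cdots e_m$ put $P(A_\varepsilon)=\prod_{l=1}^mV_{e_1\cdots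 e_l}$, and $\Pi_{\alpha_m}$ is the law of $(P(A_\varepsilon))_{\varepsilon\in{\mathscr E}_m}$ (a coherent system). Tight topology: coarsest making $P\mapsto\int f\,dP$ continuous for bounded continuous $f$; a measure projects to $\Pi_{\alpha_m}$ if $\Pi_{\alpha_m}$ is the law of $(P(A))_{A\in\alpha_m}$. *)

theory Defs
  imports "HOL-Probability.Probability"
begin

text \<open>Binary strings are bool lists; False = 0, True = 1; the first list element is
the most significant bit e1. Concatenation eps e is eps @ [e].\<close>

definition strings :: "nat \<Rightarrow> bool list set" where
  "strings m = {xs. length xs = m}"

definition bin_val :: "bool list \<Rightarrow> nat" where
  "bin_val xs = foldl (\<lambda>a b. 2 * a + (if b then 1 else 0)) 0 xs"

definition dyadic_set :: "bool list \<Rightarrow> real set" where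
  "dyadic_set xs = {real (bin_val xs) / 2 ^ length xs <.. (real (bin_val xs) + 1) / 2 ^ length xs}"

definition unit_borel :: "real measure" where
  "unit_borel = restrict_space borel {0<..1}"

definition M1 :: "real measure set" where
  "M1 = {P. prob_space P \<and> sets P = sets unit_borel}"

definition tight_topology :: "real measure topology" where
  "tight_topology = topology_generated_by
     {{P \<in> M1. (\<integral>x. f x \<partial>P) \<in> U} | f U.
        continuous_on {0<..1} f \<and> bounded (f ` {0<..1}) \<and> open (U :: real set)}"

definition borel_of_top :: "'a topology \<Rightarrow> 'a measure" where
  "borel_of_top T = sigma (topspace T) {U. openin T U}"

definition radon_prob :: "'a topology \<Rightarrow> 'a measure \<Rightarrow> bool" where
  "radon_prob T \<mu> \<longleftrightarrow> prob_space \<mu> \<and> sets \<mu> = sets (borel_of_top T) \<and>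
     (\<forall>B \<in> sets \<mu>. emeasure \<mu> B =
        (SUP K \<in> {K. compactin T K \<and> K \<subseteq> B \<and> K \<in> sets \<mu>}. emeasure \<mu> K))"

definition beta_measure :: "real \<Rightarrow> real \<Rightarrow> real measure" where
  "beta_measure a b = density lborel (\<lambda>x. ennreal (indicator {0<..<1} x *
      (x powr (a - 1) * (1 - x) powr (b - 1) / Beta a b)))"

text \<open>Given the values v eps = V_{eps0} (for length eps < m), V_{eps0} = v eps and
V_{eps1} = 1 - v eps.\<close>
definition V_of :: "(bool list \<Rightarrow> real) \<Rightarrow> bool list \<Rightarrow> real" where
  "V_of v xs = (if last xs then 1 - v (butlast xs) else v (butlast xs))"

definition hist_of :: "nat \<Rightarrow> (bool list \<Rightarrow> real) \<Rightarrow> (bool list \<Rightarrow> real)" where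
  "hist_of m v = (\<lambda>eps \<in> strings m. \<Prod>l \<in> {1..m}. V_of v (take l eps))"

definition polya_hist :: "(bool list \<Rightarrow> real) \<Rightarrow> nat \<Rightarrow> (bool list \<Rightarrow> real) measure" where
  "polya_hist \<beta> m = distr
     (PiM {eps. length eps < m} (\<lambda>eps. beta_measure (\<beta> (eps @ [False])) (\<beta> (eps @ [True]))))
     (PiM (strings m) (\<lambda>_. borel)) (hist_of m)"

definition proj_hist :: "nat \<Rightarrow> real measure \<Rightarrow> (bool list \<Rightarrow> real)" where
  "proj_hist m P = (\<lambda>eps \<in> strings m. measure P (dyadic_set eps))"

definition projects_to_polya :: "(bool list \<Rightarrow> real) \<Rightarrow> real measure measure \<Rightarrow> bool" where
  "projects_to_polya \<beta> \<mu> \<longleftrightarrow>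
     (\<forall>m. distr \<mu> (PiM (strings m) (\<lambda>_. borel)) (proj_hist m) = polya_hist \<beta> m)"

end

theory Submission
  imports Defs
begin

text \<open>A measure \<open>P\<close> on \<open>(0,1]\<close> is encoded by its dyadic masses \<open>hist P = (P A\<^sub>\<epsilon>)\<^sub>\<epsilon>\<close>, a point of the
  Polish space of real functions on binary strings. The encoding is injective, and its image is the
  Borel set of additive nonnegative arrays of total mass \<open>1\<close> with \<open>x (\<epsilon> 0\<^sup>n) \<rightarrow> 0\<close> for every \<open>\<epsilon>\<close>: the last
  condition is exactly what countable additivity requires at the open left end points of the cells.
  Convergence of all dyadic masses implies tight convergence, so the decoding map is continuous,
  while the encoding is Borel measurable. Hence every Borel probability on \<open>M\<^sup>1((0,1])\<close> is
  determined by its finite histograms and inherits inner regularity from the Polish space, and the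
  question reduces to whether the infinite beta product lives on the image of the encoding. As
  \<open>P A\<close> for the cell \<open>A\<close> of \<open>\<epsilon> 0\<^sup>n\<close> decreases in \<open>n\<close> and its mean is a positive
  constant times the \<open>n\<close>-th partial product of the statement, it tends to \<open>0\<close> almost surely if and only if the partial products do.\<close>

section \<open>Dyadic cells and histograms\<close>

lemma bin_val_Nil [simp]: "bin_val [] = 0"
  by (simp add: bin_val_def)

lemma bin_val_snoc [simp]: "bin_val (xs @ [b]) = 2 * bin_val xs + (if b then 1 else 0)"
  by (simp add: bin_val_def)

lemma bin_val_zeros [simp]: "bin_val (xs @ replicate n False) = bin_val xs * 2 ^ n"
proof (induction n)
  case (Suc n)
  have "xs @ replicate (Suc n) False = (xs @ replicate n False) @ [False]"
    by (simp add: replicate_append_same)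
  then show ?case
    using Suc by (simp only: bin_val_snoc) simp
qed simp

lemma bin_val_less: "bin_val xs < 2 ^ length xs"
  by (induction xs rule: rev_induct) (auto split: if_splits)

lemma bin_val_inj: "length xs = length ys \<Longrightarrow> bin_val xs = bin_val ys \<Longrightarrow> xs = ys"
proof (induction xs arbitrary: ys rule: rev_induct)
  case (snoc x xs)
  then obtain z zs where ys: "ys = zs @ [z]"
    by (cases ys rule: rev_cases) auto
  have "2 * bin_val xs + (if x then 1 else 0) = 2 * bin_val zs + (if z then 1 else 0)"
    using snoc.prems by (simp add: ys)
  then have "bin_val xs = bin_val zs \<and> x = z"
    by (cases x; cases z) (simp_all, presburger+)
  then show ?case
    using snoc by (simp add: ys)
qed simp

lemma bin_val_surj: "k < 2 ^ m \<Longrightarrow> \<exists>xs\<in>strings m. bin_val xs = k"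
proof (induction m arbitrary: k)
  case (Suc m)
  then have "k div 2 < 2 ^ m"
    by auto
  then obtain xs where "xs \<in> strings m" "bin_val xs = k div 2"
    using Suc.IH by blast
  then show ?case
    by (intro bexI[of _ "xs @ [odd k]"]) (auto simp: strings_def)
qed (simp add: strings_def)

lemma finite_strings [simp, intro]: "finite (strings m)"
  using finite_lists_length_eq[of "UNIV :: bool set" m] by (simp add: strings_def)

text \<open>Grouping strings by their prefix of length \<open>n\<close> turns every comparison of
  adjacent levels into a termwise one.\<close>

lemma sum_strings_Suc:
  "(\<Sum>ys\<in>strings (Suc n). g ys) = (\<Sum>xs\<in>strings n. g (xs @ [False]) + g (xs @ [True]))"
proof -
  have "strings (Suc n) = (\<lambda>xs. xs @ [False]) ` strings n \<union> (\<lambda>xs. xs @ [True]) ` strings n"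
  proof (intro equalityI subsetI)
    fix ys :: "bool list" assume "ys \<in> strings (Suc n)"
    then obtain xs b where "ys = xs @ [b]" "xs \<in> strings n"
      by (cases ys rule: rev_cases) (simp_all add: strings_def)
    then show "ys \<in> (\<lambda>xs. xs @ [False]) ` strings n \<union> (\<lambda>xs. xs @ [True]) ` strings n"
      by (cases b) simp_all
  qed (auto simp: strings_def)
  moreover have "(\<lambda>xs. xs @ [False]) ` strings n \<inter> (\<lambda>xs. xs @ [True]) ` strings n = {}"
    by blast
  ultimately show ?thesis
    by (simp add: sum.union_disjoint sum.reindex inj_on_def sum.distrib)
qed

text \<open>Cells are open on the left and closed on the right, so rounding up finds the cell of
  \<open>t\<close>. Disjointness and covering then reduce to injectivity and surjectivity of
  \<open>bin_val\<close> on a level.\<close>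

lemma in_dyadic_set_iff: "t \<in> dyadic_set xs \<longleftrightarrow> \<lceil>t * 2 ^ length xs\<rceil> = int (bin_val xs) + 1"
  by (simp add: dyadic_set_def ceiling_eq_iff pos_divide_less_eq pos_le_divide_eq)

lemma dyadic_set_subset: "dyadic_set xs \<subseteq> {0<..1}"
proof -
  have "real (bin_val xs) + 1 \<le> 2 ^ length xs"
    using bin_val_less[of xs] by (metis Suc_leI of_nat_Suc of_nat_le_iff of_nat_numeral of_nat_power add.commute)
  then have "(real (bin_val xs) + 1) / 2 ^ length xs \<le> 1"
    by simp
  moreover have "0 \<le> real (bin_val xs) / 2 ^ length xs"
    by simp
  ultimately show ?thesis
    unfolding dyadic_set_def subset_iff greaterThanAtMost_iff by linarith
qed

lemma dyadic_set_Nil: "dyadic_set [] = {0<..1}"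
  by (simp add: dyadic_set_def)

lemma dyadic_set_unique:
  "xs \<in> strings m \<Longrightarrow> ys \<in> strings m \<Longrightarrow> t \<in> dyadic_set xs \<Longrightarrow> t \<in> dyadic_set ys \<Longrightarrow> xs = ys"
  by (auto simp: in_dyadic_set_iff strings_def intro: bin_val_inj)

lemma dyadic_set_exists:
  assumes "t \<in> {0<..1}"
  obtains xs where "xs \<in> strings m" "t \<in> dyadic_set xs"
proof -
  have "\<lceil>t * 2 ^ m\<rceil> > 0"
    using assms by simp
  moreover have "\<lceil>t * 2 ^ m\<rceil> \<le> 2 ^ m"
    using assms by (simp add: ceiling_le_iff)
  ultimately have "nat (\<lceil>t * 2 ^ m\<rceil> - 1) < 2 ^ m"
    by (simp add: nat_less_iff)
  then obtain xs where "xs \<in> strings m" "bin_val xs = nat (\<lceil>t * 2 ^ m\<rceil> - 1)"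
    using bin_val_surj by blast
  then show ?thesis
    using that \<open>\<lceil>t * 2 ^ m\<rceil> > 0\<close> by (auto simp: in_dyadic_set_iff strings_def)
qed

lemma dyadic_set_split: "dyadic_set xs = dyadic_set (xs @ [False]) \<union> dyadic_set (xs @ [True])"
  by (auto simp: dyadic_set_def field_simps)

lemma dyadic_set_split_disjoint: "dyadic_set (xs @ [False]) \<inter> dyadic_set (xs @ [True]) = {}"
  using dyadic_set_unique[of "xs @ [False]" "Suc (length xs)" "xs @ [True]"]
  by (auto simp: strings_def)

lemma dyadic_set_dist:
  "s \<in> dyadic_set xs \<Longrightarrow> t \<in> dyadic_set xs \<Longrightarrow> \<bar>s - t\<bar> < 1 / 2 ^ length xs"
  by (auto simp: dyadic_set_def add_divide_distrib)

section \<open>Probability measures on (0,1] and their arrays of dyadic masses\<close>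

lemma M1D:
  assumes "P \<in> M1"
  shows "prob_space P" "space P = {0<..1}" "sets P = sets unit_borel"
proof -
  show "prob_space P" "sets P = sets unit_borel"
    using assms by (auto simp: M1_def)
  then show "space P = {0<..1}"
    using sets_eq_imp_space_eq[of P unit_borel] by (simp add: unit_borel_def space_restrict_space)
qed

lemma sets_unit_borelI: "A \<in> sets borel \<Longrightarrow> A \<subseteq> {0<..1} \<Longrightarrow> A \<in> sets unit_borel"
  by (auto simp: unit_borel_def sets_restrict_space)

lemma dyadic_set_borel [measurable]: "dyadic_set xs \<in> sets borel"
  by (simp add: dyadic_set_def)

lemma dyadic_set_unit_borel: "dyadic_set xs \<in> sets unit_borel"
  by (intro sets_unit_borelI dyadic_set_subset) simp

definition hist :: "real measure \<Rightarrow> bool list \<Rightarrow> real" where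
  "hist P xs = measure P (dyadic_set xs)"

text \<open>The cells along appended zeros share a left end point, belong to none of its points'
  neighbours on the left, and exclude that end point itself. They therefore shrink to the empty set,
  and continuity from above applies.\<close>

lemma hist_zeros_tendsto_0:
  assumes "P \<in> M1"
  shows "(\<lambda>n. hist P (xs @ replicate n False)) \<longlonglongrightarrow> 0"
proof -
  interpret prob_space P by (rule M1D[OF assms])
  define A where "A n = dyadic_set (xs @ replicate n False)" for n
  have A: "A n = {real (bin_val xs) / 2 ^ length xs <.. real (bin_val xs) / 2 ^ length xs + (1/2) ^ n / 2 ^ length xs}" for n
    by (simp add: A_def dyadic_set_def power_add add_divide_distrib power_divide mult.commute)
  have "range A \<subseteq> sets P"
    using dyadic_set_unit_borel by (auto simp: M1D(3)[OF assms] A_def)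
  moreover have "decseq A"
    unfolding A decseq_def
  proof (intro allI impI)
    fix m n :: nat assume "m \<le> n"
    then have "(1 / 2 :: real) ^ n / 2 ^ length xs \<le> (1 / 2) ^ m / 2 ^ length xs"
      by (intro divide_right_mono power_decreasing) simp_all
    then show "{real (bin_val xs) / 2 ^ length xs <.. real (bin_val xs) / 2 ^ length xs + (1 / 2) ^ n / 2 ^ length xs}
        \<subseteq> {real (bin_val xs) / 2 ^ length xs <.. real (bin_val xs) / 2 ^ length xs + (1 / 2) ^ m / 2 ^ length xs}"
      unfolding subset_iff greaterThanAtMost_iff by linarith
  qed
  ultimately have "(\<lambda>n. measure P (A n)) \<longlonglongrightarrow> measure P (\<Inter>n. A n)"
    by (rule finite_Lim_measure_decseq)
  \<comment> \<open>A common point would lie below the limit of the right end points, which is the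
    excluded left end point.\<close>
  also have "(\<Inter>n. A n) = {}"
  proof (rule ccontr)
    assume "(\<Inter>n. A n) \<noteq> {}"
    then obtain t where t: "\<And>n. t \<in> A n" by auto
    have "(\<lambda>n. real (bin_val xs) / 2 ^ length xs + (1/2) ^ n / 2 ^ length xs) \<longlonglongrightarrow> real (bin_val xs) / 2 ^ length xs + 0 / 2 ^ length xs"
      by (intro tendsto_intros LIMSEQ_power_zero) auto
    then have "t \<le> real (bin_val xs) / 2 ^ length xs + 0 / 2 ^ length xs"
      by (rule LIMSEQ_le_const) (use t in \<open>auto simp: A\<close>)
    then show False
      using t[of 0] by (auto simp: A)
  qed
  finally show ?thesis
    by (simp add: A_def hist_def)
qed

text \<open>Along \<open>\<epsilon> 0\<^sup>n\<close> the entries decrease, so the last clause says that they tend to \<open>0\<close>; in this form it is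
  visibly a countable combination of Borel conditions.\<close>

definition hist_set :: "(bool list \<Rightarrow> real) set" where
  "hist_set = {x. (\<forall>xs. 0 \<le> x xs) \<and> x [] = 1 \<and> (\<forall>xs. x xs = x (xs @ [False]) + x (xs @ [True])) \<and>
     (\<forall>xs k. \<exists>n. x (xs @ replicate n False) < 1 / real (Suc k))}"

lemma hist_split:
  assumes "P \<in> M1"
  shows "hist P xs = hist P (xs @ [False]) + hist P (xs @ [True])"
proof -
  interpret prob_space P by (rule M1D[OF assms])
  show ?thesis
    unfolding hist_def dyadic_set_split[of xs]
    by (intro finite_measure_Union)
      (use dyadic_set_unit_borel dyadic_set_split_disjoint in \<open>auto simp: M1D(3)[OF assms]\<close>)
qed

lemma hist_in_hist_set:
  assumes "P \<in> M1"
  shows "hist P \<in> hist_set"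
proof -
  interpret prob_space P by (rule M1D[OF assms])
  have "\<exists>n. hist P (xs @ replicate n False) < 1 / real (Suc k)" for xs k
    using order_tendstoD(2)[OF hist_zeros_tendsto_0[OF assms], of "1 / real (Suc k)"]
    by (auto simp: eventually_sequentially)
  moreover have "hist P [] = 1"
    using prob_space by (simp add: hist_def dyadic_set_Nil M1D(2)[OF assms])
  moreover have "0 \<le> hist P xs" for xs
    by (simp add: hist_def)
  ultimately show ?thesis
    unfolding hist_set_def using hist_split[OF assms] by blast
qed

section \<open>Every admissible array comes from a measure\<close>

context
  fixes x :: "bool list \<Rightarrow> real"
  assumes x: "x \<in> hist_set"
begin

lemma hist_set_nonneg: "0 \<le> x xs"
  and hist_set_Nil: "x [] = 1"
  and hist_set_split: "x xs = x (xs @ [False]) + x (xs @ [True])"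
  using x unfolding hist_set_def by blast+

lemma hist_set_zeros_antimono:
  "m \<le> n \<Longrightarrow> x (xs @ replicate n False) \<le> x (xs @ replicate m False)"
proof (rule decseqD[of "\<lambda>n. x (xs @ replicate n False)"])
  show "decseq (\<lambda>n. x (xs @ replicate n False))"
  proof (rule decseq_SucI)
    fix n
    have "xs @ replicate (Suc n) False = (xs @ replicate n False) @ [False]"
      by (simp add: replicate_append_same)
    then show "x (xs @ replicate (Suc n) False) \<le> x (xs @ replicate n False)"
      using hist_set_split[of "xs @ replicate n False"] hist_set_nonneg[of "(xs @ replicate n False) @ [True]"]
      by simp
  qed
qed

lemma hist_set_zeros_tendsto_0: "(\<lambda>n. x (xs @ replicate n False)) \<longlonglongrightarrow> 0"
proof (rule LIMSEQ_I)
  fix e :: real assume "e > 0"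
  then obtain k where k: "1 / real (Suc k) < e"
    using nat_approx_posE by blast
  obtain n where n: "x (xs @ replicate n False) < 1 / real (Suc k)"
    using x unfolding hist_set_def by blast
  have "norm (x (xs @ replicate i False) - 0) < e" if "i \<ge> n" for i
    using hist_set_zeros_antimono[OF that, of xs] hist_set_nonneg[of "xs @ replicate i False"] n k by simp
  then show "\<exists>n. \<forall>i\<ge>n. norm (x (xs @ replicate i False) - 0) < e"
    by blast
qed

text \<open>Over-approximations of the distribution function: the mass of all level \<open>n\<close> cells whose left
  end point is at most \<open>t\<close>.  Counting the cell just to the right of \<open>t\<close> makes the
  infimum over \<open>n\<close> right continuous.\<close>

private definition L :: "nat \<Rightarrow> real \<Rightarrow> real" where
  "L n t = (\<Sum>xs\<in>strings n. if real (bin_val xs) / 2 ^ n \<le> t then x xs else 0)"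

private definition F :: "real \<Rightarrow> real" where
  "F t = (INF n. L n t)"

text \<open>This is the value that the distribution function must take at \<open>k / 2 ^ n\<close>.
  Unlike \<open>L\<close>, it leaves out the cell that starts at that point.\<close>

private definition S :: "nat \<Rightarrow> nat \<Rightarrow> real" where
  "S n k = (\<Sum>xs\<in>strings n. if bin_val xs < k then x xs else 0)"

private lemma L_nonneg: "0 \<le> L n t"
  unfolding L_def by (intro sum_nonneg) (auto simp: hist_set_nonneg)

private lemma bdd_below_L: "bdd_below (range (\<lambda>n. L n t))"
  by (intro bdd_belowI[of _ 0]) (auto simp: L_nonneg)

private lemma L_mono: "s \<le> t \<Longrightarrow> L n s \<le> L n t"
  unfolding L_def by (intro sum_mono) (auto simp: hist_set_nonneg)

text \<open>When a cell splits, the left half keeps the left end point and the right half gets a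
  larger one. Refinement can thus only drop the right half of a counted cell.\<close>

private lemma L_decseq: "decseq (\<lambda>n. L n t)"
proof (rule decseq_SucI)
  fix n
  have "L (Suc n) t \<le> (\<Sum>xs\<in>strings n. if real (bin_val xs) / 2 ^ n \<le> t then x xs else 0)"
    unfolding L_def sum_strings_Suc
  proof (rule sum_mono)
    fix xs
    have "real (bin_val xs) / 2 ^ n \<le> real (Suc (2 * bin_val xs)) / 2 ^ Suc n"
      by (simp add: field_simps)
    then show "(if real (bin_val (xs @ [False])) / 2 ^ Suc n \<le> t then x (xs @ [False]) else 0) +
          (if real (bin_val (xs @ [True])) / 2 ^ Suc n \<le> t then x (xs @ [True]) else 0)
        \<le> (if real (bin_val xs) / 2 ^ n \<le> t then x xs else 0)"
      using hist_set_split[of xs] hist_set_nonneg[of "xs @ [True]"] hist_set_nonneg[of "xs @ [False]"]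
      by auto
  qed
  then show "L (Suc n) t \<le> L n t"
    by (simp add: L_def)
qed

private lemma L_tendsto_F: "(\<lambda>n. L n t) \<longlonglongrightarrow> F t"
  unfolding F_def by (rule LIMSEQ_decseq_INF[OF bdd_below_L L_decseq])

private lemma F_le_L: "F t \<le> L n t"
  unfolding F_def by (rule cINF_lower[OF bdd_below_L]) simp

private lemma F_mono: "s \<le> t \<Longrightarrow> F s \<le> F t"
  by (rule LIMSEQ_le[OF L_tendsto_F L_tendsto_F]) (auto intro: L_mono)

text \<open>Monotonicity gives the lower bound. For the upper one, a level has finitely many left
  end points, so \<open>L n\<close> is constant immediately to the right of \<open>a\<close>, and it
  dominates \<open>F\<close> there.\<close>

private lemma F_right_cont: "continuous (at_right a) F"
  unfolding continuous_within
proof (rule order_tendstoI)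
  fix y assume "y < F a"
  then show "\<forall>\<^sub>F s in at_right a. y < F s"
    by (intro eventually_at_right_less[THEN eventually_mono]) (use F_mono[of a] in \<open>force intro: less_le_trans\<close>)
next
  fix y assume "F a < y"
  then obtain n where n: "L n a < y"
    using order_tendstoD(2)[OF L_tendsto_F \<open>F a < y\<close>] by (auto simp: eventually_sequentially)
  have "\<forall>\<^sub>F s in at_right a. \<forall>xs\<in>strings n. real (bin_val xs) / 2 ^ n \<le> s \<longleftrightarrow> real (bin_val xs) / 2 ^ n \<le> a"
  proof (intro eventually_ball_finite ballI finite_strings)
    fix xs
    show "\<forall>\<^sub>F s in at_right a. real (bin_val xs) / 2 ^ n \<le> s \<longleftrightarrow> real (bin_val xs) / 2 ^ n \<le> a"
    proof (cases "real (bin_val xs) / 2 ^ n \<le> a")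
      case True
      then show ?thesis
        by (intro eventually_at_right_less[THEN eventually_mono]) auto
    next
      case False
      then show ?thesis
        by (intro eventually_at_right_field[THEN iffD2] exI[of _ "real (bin_val xs) / 2 ^ n"]) auto
    qed
  qed
  then show "\<forall>\<^sub>F s in at_right a. F s < y"
  proof eventually_elim
    case (elim s)
    then have "L n s = L n a"
      unfolding L_def by (intro sum.cong) auto
    then show ?case
      using F_le_L[of s n] n by linarith
  qed
qed

text \<open>Both indices describe the same point, and no cell of a finer level straddles it: the two
  children of a cell lie on the same side of the point as their parent.\<close>

private lemma S_refine: "S (m + n) (k * 2 ^ n) = S m k"
proof (induction n)
  case (Suc n)
  have "S (Suc (m + n)) (2 * (k * 2 ^ n)) = S (m + n) (k * 2 ^ n)"
    unfolding S_def sum_strings_Suc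
  proof (intro sum.cong refl)
    fix xs
    show "(if bin_val (xs @ [False]) < 2 * (k * 2 ^ n) then x (xs @ [False]) else 0) +
        (if bin_val (xs @ [True]) < 2 * (k * 2 ^ n) then x (xs @ [True]) else 0) =
        (if bin_val xs < k * 2 ^ n then x xs else 0)"
      using hist_set_split[of xs] by auto
  qed
  then show ?case
    using Suc by (simp add: ac_simps)
qed simp

private lemma S_Suc: "S n (Suc k) = S n k + (\<Sum>xs\<in>strings n. if bin_val xs = k then x xs else 0)"
  unfolding S_def sum.distrib[symmetric] by (intro sum.cong) auto

private lemma S_Suc_bin_val:
  assumes "xs \<in> strings n"
  shows "S n (Suc (bin_val xs)) = S n (bin_val xs) + x xs"
proof -
  have "(\<Sum>ys\<in>strings n. if bin_val ys = bin_val xs then x ys else 0) =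
      (\<Sum>ys\<in>strings n. if ys = xs then x ys else 0)"
    using assms by (intro sum.cong) (auto simp: strings_def dest: bin_val_inj)
  then show ?thesis
    using assms by (simp add: S_Suc)
qed

text \<open>At level \<open>m + n\<close>, \<open>L\<close> exceeds \<open>S m k\<close> by the mass
  of the single cell that starts at \<open>k / 2 ^ m\<close>. These cells are reached by appending
  zeros, so their mass vanishes in the limit by the last clause of \<open>hist_set\<close>.\<close>

private lemma F_dyadic:
  assumes "k \<le> 2 ^ m"
  shows "F (real k / 2 ^ m) = S m k"
proof -
  have L: "L (m + n) (real k / 2 ^ m) = S m k + (\<Sum>xs\<in>strings (m + n). if bin_val xs = k * 2 ^ n then x xs else 0)" for n
  proof -
    have "(real (bin_val xs) / 2 ^ (m + n) \<le> real k / 2 ^ m) = (bin_val xs < Suc (k * 2 ^ n))" for xs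
    proof -
      have "(real (bin_val xs) / 2 ^ (m + n) \<le> real k / 2 ^ m) = (real (bin_val xs) \<le> real (k * 2 ^ n))"
        by (simp add: field_simps power_add)
      then show ?thesis
        by (simp only: of_nat_le_iff less_Suc_eq_le)
    qed
    then have "L (m + n) (real k / 2 ^ m) = S (m + n) (Suc (k * 2 ^ n))"
      by (simp add: L_def S_def)
    then show ?thesis
      by (simp add: S_Suc S_refine)
  qed
  have "(\<lambda>n. \<Sum>xs\<in>strings (m + n). if bin_val xs = k * 2 ^ n then x xs else 0) \<longlonglongrightarrow> 0"
  proof (cases "k < 2 ^ m")
    case True
    then obtain ys where ys: "ys \<in> strings m" "bin_val ys = k"
      using bin_val_surj by blast
    have "(\<Sum>xs\<in>strings (m + n). if bin_val xs = k * 2 ^ n then x xs else 0) =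
        (\<Sum>xs\<in>strings (m + n). if xs = ys @ replicate n False then x xs else 0)" for n
      using ys by (intro sum.cong) (auto simp: strings_def intro!: bin_val_inj)
    moreover have "ys @ replicate n False \<in> strings (m + n)" for n
      using ys by (simp add: strings_def)
    ultimately show ?thesis
      using hist_set_zeros_tendsto_0[of ys] by simp
  next
    \<comment> \<open>The point is then the right end of the unit interval, where no cell
      starts.\<close>
    case False
    have "(\<Sum>xs\<in>strings (m + n). if bin_val xs = k * 2 ^ n then x xs else 0) = 0" for n
    proof (intro sum.neutral ballI)
      fix xs assume "xs \<in> strings (m + n)"
      then have "bin_val xs < 2 ^ m * 2 ^ n"
        using bin_val_less[of xs] by (simp add: strings_def power_add)
      also have "\<dots> \<le> k * 2 ^ n"
        using False by simp
      finally show "(if bin_val xs = k * 2 ^ n then x xs else 0) = 0"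
        by simp
    qed
    then show ?thesis
      by simp
  qed
  then have "(\<lambda>n. L (m + n) (real k / 2 ^ m)) \<longlonglongrightarrow> S m k + 0"
    unfolding L by (intro tendsto_intros)
  moreover have "(\<lambda>n. L (m + n) (real k / 2 ^ m)) \<longlonglongrightarrow> F (real k / 2 ^ m)"
    using LIMSEQ_ignore_initial_segment[OF L_tendsto_F, where k = m] by (simp add: add.commute)
  ultimately show ?thesis
    using LIMSEQ_unique by fastforce
qed

text \<open>The Lebesgue-Stieltjes measure of \<open>F\<close> works: the increment of
  \<open>F\<close> over a cell is a difference of consecutive values of \<open>S\<close>, which is
  the prescribed entry.\<close>

lemma hist_set_measure_exists: "\<exists>P\<in>M1. hist P = x"
proof -
  define P where "P = restrict_space (interval_measure F) {0<..1}"
  have em: "emeasure P (dyadic_set xs) = ennreal (x xs)" for xs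
  proof -
    have "emeasure P (dyadic_set xs) = emeasure (interval_measure F) (dyadic_set xs)"
      unfolding P_def by (rule emeasure_restrict_space) (auto simp: dyadic_set_subset)
    also have "\<dots> = ennreal (F ((real (bin_val xs) + 1) / 2 ^ length xs) - F (real (bin_val xs) / 2 ^ length xs))"
      unfolding dyadic_set_def
      by (rule emeasure_interval_measure_Ioc) (auto intro: F_mono F_right_cont divide_right_mono)
    also have "F ((real (bin_val xs) + 1) / 2 ^ length xs) = S (length xs) (Suc (bin_val xs))"
      using F_dyadic[of "Suc (bin_val xs)" "length xs"] bin_val_less[of xs] by (simp add: add.commute)
    also have "F (real (bin_val xs) / 2 ^ length xs) = S (length xs) (bin_val xs)"
      using bin_val_less[of xs] by (intro F_dyadic) simp
    also have "S (length xs) (Suc (bin_val xs)) = S (length xs) (bin_val xs) + x xs"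
      by (rule S_Suc_bin_val) (simp add: strings_def)
    finally show ?thesis
      by simp
  qed
  have "prob_space P"
    using em[of "[]"] by (intro prob_spaceI) (simp add: dyadic_set_Nil P_def space_restrict_space hist_set_Nil)
  moreover have "sets P = sets unit_borel"
    unfolding P_def unit_borel_def by (intro sets_restrict_space_cong) simp
  moreover have "hist P = x"
    using em by (intro ext) (simp add: hist_def measure_def hist_set_nonneg)
  ultimately show ?thesis
    by (auto simp: M1_def)
qed

end

section \<open>Tight convergence from convergence of histograms\<close>

lemma unit_measurable_M1: "P \<in> M1 \<Longrightarrow> f \<in> borel_measurable unit_borel \<Longrightarrow> f \<in> borel_measurable P"
  by (metis M1D(3) measurable_cong_sets)

lemma integrable_M1:
  fixes f :: "real \<Rightarrow> real"
  assumes "P \<in> M1" "f \<in> borel_measurable unit_borel" "\<And>t. t \<in> {0<..1} \<Longrightarrow> \<bar>f t\<bar> \<le> C"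
  shows "integrable P f"
proof -
  interpret prob_space P by (rule M1D[OF assms(1)])
  show ?thesis
    using assms by (intro integrable_const_bound[of _ C] AE_I2) (auto simp: M1D(2) intro: unit_measurable_M1)
qed

text \<open>Replacing \<open>f\<close> on each cell by its infimum gives step functions that
  converge to \<open>f\<close> from below and whose integrals are finite combinations of dyadic
  masses. Lower semicontinuity, the hypothesis \<open>lsc\<close>, suffices, so the lemma serves
  continuous functions and indicators of open sets alike.\<close>

lemma hist_converges_liminf_integral:
  fixes f :: "real \<Rightarrow> real"
  assumes P: "P \<in> M1" and Q: "\<And>n. Q n \<in> M1"
    and conv: "\<And>xs. (\<lambda>n. hist (Q n) xs) \<longlonglongrightarrow> hist P xs"
    and f: "f \<in> borel_measurable unit_borel"
    and bound: "\<And>t. t \<in> {0<..1} \<Longrightarrow> \<bar>f t\<bar> \<le> C"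
    and lsc: "\<And>t e. t \<in> {0<..1} \<Longrightarrow> 0 < e \<Longrightarrow> \<exists>d>0. \<forall>s\<in>{0<..1}. \<bar>s - t\<bar> < d \<longrightarrow> f t - e < f s"
    and e: "0 < e"
  shows "\<forall>\<^sub>F n in sequentially. (\<integral>t. f t \<partial>P) - e < (\<integral>t. f t \<partial>Q n)"
proof -
  define c where "c xs = (INF s\<in>dyadic_set xs. f s)" for xs
  define g where "g m t = (\<Sum>xs\<in>strings m. c xs * indicator (dyadic_set xs) t)" for m t
  have bdd: "bdd_below (f ` dyadic_set xs)" for xs
    using dyadic_set_subset[of xs] by (intro bdd_belowI[of _ "-C"]) (force dest: bound)
  have c_le: "c xs \<le> f t" if "t \<in> dyadic_set xs" for xs t
    unfolding c_def by (rule cINF_lower[OF bdd that])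
  have c_ge: "B \<le> c xs" if "t \<in> dyadic_set xs" "\<And>s. s \<in> dyadic_set xs \<Longrightarrow> B \<le> f s" for B xs t
    unfolding c_def by (rule cINF_greatest) (use that in auto)
  have g_eq: "g m t = c xs" if "xs \<in> strings m" "t \<in> dyadic_set xs" for m xs t
  proof -
    have "g m t = (\<Sum>ys\<in>strings m. if ys = xs then c ys else 0)"
      unfolding g_def using that dyadic_set_unique
      by (intro sum.cong refl) (auto simp: indicator_def)
    then show ?thesis
      using that by simp
  qed
  have g_le: "g m t \<le> f t" and g_bound: "\<bar>g m t\<bar> \<le> C" if t: "t \<in> {0<..1}" for m t
  proof -
    obtain xs where xs: "xs \<in> strings m" "t \<in> dyadic_set xs"
      using dyadic_set_exists[OF t] by blast
    then show "g m t \<le> f t"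
      using c_le g_eq by simp
    moreover have "-C \<le> c xs"
      using xs dyadic_set_subset[of xs] by (intro c_ge) (force dest: bound)+
    ultimately show "\<bar>g m t\<bar> \<le> C"
      using xs bound[OF t] by (simp add: g_eq abs_le_iff)
  qed
  have g_meas: "g m \<in> borel_measurable unit_borel" for m
    unfolding g_def using dyadic_set_unit_borel by measurable
  \<comment> \<open>The cell of \<open>t\<close> at level \<open>m\<close> has diameter at most
    \<open>(1 / 2) ^ m\<close>, so it eventually lies where \<open>f\<close> exceeds
    \<open>f t - r / 2\<close>, and so does the infimum up to equality.\<close>
  have g_tendsto: "(\<lambda>m. g m t) \<longlonglongrightarrow> f t" if t: "t \<in> {0<..1}" for t
  proof (rule LIMSEQ_I)
    fix r :: real assume "r > 0"
    then obtain d where d: "d > 0" "\<And>s. s \<in> {0<..1} \<Longrightarrow> \<bar>s - t\<bar> < d \<Longrightarrow> f t - r / 2 < f s"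
      using lsc[OF t, of "r / 2"] by auto
    obtain m0 where m0: "(1 / 2) ^ m0 < d"
      using real_arch_pow_inv[OF \<open>d > 0\<close>, of "1 / 2"] by auto
    have "norm (g m t - f t) < r" if "m \<ge> m0" for m
    proof -
      obtain xs where xs: "xs \<in> strings m" "t \<in> dyadic_set xs"
        using dyadic_set_exists[OF t] by blast
      have "f t - r / 2 \<le> c xs"
      proof (rule c_ge[OF xs(2)])
        fix s assume s: "s \<in> dyadic_set xs"
        have "\<bar>s - t\<bar> < (1 / 2) ^ m"
          using dyadic_set_dist[OF s xs(2)] xs(1) by (simp add: strings_def power_divide)
        also have "\<dots> \<le> (1 / 2) ^ m0"
          using that by (intro power_decreasing) simp_all
        finally show "f t - r / 2 \<le> f s"
          using m0 d(2)[of s] s dyadic_set_subset[of xs] by (auto intro: less_imp_le)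
      qed
      then show ?thesis
        using g_eq[OF xs] g_le[OF t, of m] \<open>r > 0\<close> by simp
    qed
    then show "\<exists>m0. \<forall>m\<ge>m0. norm (g m t - f t) < r"
      by blast
  qed
  have g_integral: "(\<integral>t. g m t \<partial>R) = (\<Sum>xs\<in>strings m. c xs * hist R xs)" if R: "R \<in> M1" for R m
  proof -
    interpret prob_space R by (rule M1D[OF R])
    have "integrable R (\<lambda>t. c xs * indicator (dyadic_set xs) t)" for xs
      using dyadic_set_unit_borel[of xs] by (simp add: M1D(3)[OF R] emeasure_eq_measure)
    moreover have "(\<integral>t. indicator (dyadic_set xs) t \<partial>R) = hist R xs" for xs
      using dyadic_set_subset[of xs] by (simp add: hist_def M1D(2)[OF R] Int_absorb2)
    ultimately show ?thesis
      unfolding g_def by (subst Bochner_Integration.integral_sum) simp_all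
  qed
  have "(\<lambda>m. \<integral>t. g m t \<partial>P) \<longlonglongrightarrow> (\<integral>t. f t \<partial>P)"
  proof (rule integral_dominated_convergence[where w = "\<lambda>_. C"])
    interpret prob_space P by (rule M1D[OF P])
    show "integrable P (\<lambda>_. C)" by simp
  qed (use f g_meas g_tendsto g_bound in \<open>auto simp: M1D(2)[OF P] intro: unit_measurable_M1[OF P]\<close>)
  \<comment> \<open>Fix one level \<open>m\<close> that loses less than \<open>e\<close> under
    \<open>P\<close>; at this fixed level the integrals under \<open>Q n\<close> converge.\<close>
  from order_tendstoD(1)[OF this, of "(\<integral>t. f t \<partial>P) - e"] e
  obtain m where m: "(\<integral>t. f t \<partial>P) - e < (\<integral>t. g m t \<partial>P)"
    by (auto simp: eventually_sequentially)
  have "(\<lambda>n. \<integral>t. g m t \<partial>Q n) \<longlonglongrightarrow> (\<integral>t. g m t \<partial>P)"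
    unfolding g_integral[OF P] g_integral[OF Q] by (intro tendsto_intros conv)
  from order_tendstoD(1)[OF this m] show ?thesis
  proof eventually_elim
    case (elim n)
    have "(\<integral>t. g m t \<partial>Q n) \<le> (\<integral>t. f t \<partial>Q n)"
      by (intro integral_mono integrable_M1[OF Q g_meas g_bound] integrable_M1[OF Q f bound])
        (auto simp: M1D(2)[OF Q] g_le)
    with elim show ?case
      by linarith
  qed
qed

lemma continuous_imp_unit_measurable:
  "continuous_on {0<..1} f \<Longrightarrow> f \<in> borel_measurable unit_borel" for f :: "real \<Rightarrow> real"
  unfolding unit_borel_def by (rule borel_measurable_continuous_on_restrict)

text \<open>The one-sided bound is applied to \<open>f\<close> and to \<open>- f\<close>, both of
  which are lower semicontinuous.\<close>

lemma hist_converges_imp_integral_tendsto: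
  fixes f :: "real \<Rightarrow> real"
  assumes P: "P \<in> M1" and Q: "\<And>n. Q n \<in> M1"
    and conv: "\<And>xs. (\<lambda>n. hist (Q n) xs) \<longlonglongrightarrow> hist P xs"
    and cont: "continuous_on {0<..1} f" and bdd: "bounded (f ` {0<..1})"
  shows "(\<lambda>n. \<integral>t. f t \<partial>Q n) \<longlonglongrightarrow> (\<integral>t. f t \<partial>P)"
proof -
  obtain C where "\<forall>y\<in>f ` {0<..1}. norm y \<le> C"
    using bdd unfolding bounded_iff by blast
  then have C: "\<bar>f t\<bar> \<le> C" if "t \<in> {0<..1}" for t
    using that by simp
  have f: "f \<in> borel_measurable unit_borel"
    by (rule continuous_imp_unit_measurable[OF cont])
  have near: "\<exists>d>0. \<forall>s\<in>{0<..1}. \<bar>s - t\<bar> < d \<longrightarrow> \<bar>f s - f t\<bar> < e" if "t \<in> {0<..1}" "0 < e" for t e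
    using cont that by (auto simp: continuous_on_iff dist_real_def)
  show ?thesis
  proof (rule order_tendstoI)
    fix a assume "a < (\<integral>t. f t \<partial>P)"
    moreover have "\<exists>d>0. \<forall>s\<in>{0<..1}. \<bar>s - t\<bar> < d \<longrightarrow> f t - e < f s" if "t \<in> {0<..1}" "0 < e" for t e
      using near[OF that] by (elim ex_forward) (auto simp: abs_less_iff)
    ultimately show "\<forall>\<^sub>F n in sequentially. a < (\<integral>t. f t \<partial>Q n)"
      using hist_converges_liminf_integral[OF P Q conv f C, of "(\<integral>t. f t \<partial>P) - a"] by simp
  next
    fix a assume "(\<integral>t. f t \<partial>P) < a"
    moreover have "\<exists>d>0. \<forall>s\<in>{0<..1}. \<bar>s - t\<bar> < d \<longrightarrow> - f t - e < - f s" if "t \<in> {0<..1}" "0 < e" for t e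
      using near[OF that] by (elim ex_forward) (auto simp: abs_less_iff)
    ultimately show "\<forall>\<^sub>F n in sequentially. (\<integral>t. f t \<partial>Q n) < a"
      using hist_converges_liminf_integral[OF P Q conv borel_measurable_uminus[OF f], of C "a - (\<integral>t. f t \<partial>P)"] C
      by simp
  qed
qed

text \<open>The indicator of an open set is lower semicontinuous, and the constant sequence
  \<open>Q\<close> has convergent histograms, so the one-sided bound applies with arbitrary
  \<open>e\<close>.\<close>

lemma hist_eq_imp_measure_open_le:
  assumes P: "P \<in> M1" and Q: "Q \<in> M1" and eq: "hist P = hist Q" and U: "open U"
  shows "measure P ({0<..1} \<inter> U) \<le> measure Q ({0<..1} \<inter> U)"
proof (rule field_le_epsilon)
  fix e :: real assume "e > 0"
  have lsc: "\<exists>d>0. \<forall>s\<in>{0<..1}. \<bar>s - t\<bar> < d \<longrightarrow> indicat_real U t - e < indicat_real U s" if "0 < e" for t e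
  proof (cases "t \<in> U")
    case True
    then obtain d where "d > 0" "\<And>s. \<bar>s - t\<bar> < d \<Longrightarrow> s \<in> U"
      using U by (auto simp: open_dist dist_real_def)
    then show ?thesis
      using that by (intro exI[of _ d]) (auto simp: indicator_def)
  qed (use that in \<open>auto intro!: exI[of _ 1] simp: indicator_def\<close>)
  have "indicat_real U \<in> borel_measurable unit_borel"
    unfolding unit_borel_def using U by (intro measurable_restrict_space1) simp
  with hist_converges_liminf_integral[OF P, of "\<lambda>_. Q" "indicator U" 1 e] Q eq lsc \<open>e > 0\<close>
  have "(\<integral>t. indicator U t \<partial>P) - e < (\<integral>t. indicator U t \<partial>Q)"
    by (auto simp: indicator_def)
  then show "measure P ({0<..1} \<inter> U) \<le> measure Q ({0<..1} \<inter> U) + e"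
    by (simp add: M1D(2)[OF P] M1D(2)[OF Q] Int_commute)
qed

text \<open>By symmetry the preceding inequality is an equality on traces of open sets, an
  intersection-stable generator of the Borel sets of (0,1].\<close>

lemma inj_on_hist: "inj_on hist M1"
proof (rule inj_onI)
  fix P Q assume P: "P \<in> M1" and Q: "Q \<in> M1" and eq: "hist P = hist Q"
  interpret P: prob_space P by (rule M1D[OF P])
  interpret Q: prob_space Q by (rule M1D[OF Q])
  have sets: "sets unit_borel = sigma_sets {0<..1} ((\<inter>) {0<..1} ` {U. open U})"
  proof -
    have borel: "sets borel = sigma_sets UNIV {U :: real set. open U}"
      by (simp add: borel_def)
    have "{0<..1::real} \<in> sets borel"
      by simp
    then show ?thesis
      unfolding unit_borel_def sets_restrict_space borel by (intro sigma_sets_Int) auto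
  qed
  show "P = Q"
  proof (rule measure_eqI_generator_eq[where E = "(\<inter>) {0<..1} ` {U. open U}" and A = "\<lambda>_. {0<..1}"])
    show "Int_stable ((\<inter>) {0<..1::real} ` {U. open U})"
    proof (rule Int_stableI)
      fix a b assume "a \<in> (\<inter>) {0<..1::real} ` {U. open U}" "b \<in> (\<inter>) {0<..1::real} ` {U. open U}"
      then obtain U V where "open U" "open V" "a = {0<..1} \<inter> U" "b = {0<..1} \<inter> V" by auto
      then show "a \<inter> b \<in> (\<inter>) {0<..1::real} ` {U. open U}"
        by (intro image_eqI[of _ _ "U \<inter> V"]) auto
    qed
    show "emeasure P X = emeasure Q X" if "X \<in> (\<inter>) {0<..1} ` {U. open U}" for X
      using that hist_eq_imp_measure_open_le[OF P Q eq] hist_eq_imp_measure_open_le[OF Q P eq[symmetric]]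
      by (auto simp: P.emeasure_eq_measure Q.emeasure_eq_measure intro!: antisym)
    show "range (\<lambda>_. {0<..1::real}) \<subseteq> (\<inter>) {0<..1} ` {U. open U}"
      by (auto intro!: image_eqI[of _ _ UNIV])
  qed (auto simp: sets M1D(3)[OF P] M1D(3)[OF Q])
qed

lemma hist_image: "hist ` M1 = hist_set"
  using hist_in_hist_set hist_set_measure_exists by force

section \<open>The tight topology, its Borel sets and the decoding map\<close>

lemma tight_subbasic_open:
  "continuous_on {0<..1} f \<Longrightarrow> bounded (f ` {0<..1}) \<Longrightarrow> open (U :: real set) \<Longrightarrow>
    openin tight_topology {P \<in> M1. (\<integral>t. f t \<partial>P) \<in> U}"
  unfolding tight_topology_def by (rule topology_generated_by_Basis) blast

lemma topspace_tight_topology: "topspace tight_topology = M1"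
proof
  show "topspace tight_topology \<subseteq> M1"
    unfolding tight_topology_def topology_generated_by_topspace by blast
  \<comment> \<open>The zero function together with \<open>UNIV\<close> exhibits all of
    \<open>M1\<close> as a subbasic open set.\<close>
  have "openin tight_topology {P \<in> M1. (\<integral>t. 0 \<partial>P) \<in> (UNIV :: real set)}"
    by (rule tight_subbasic_open) (auto simp: bounded_iff)
  then show "M1 \<subseteq> topspace tight_topology"
    using openin_subset by fastforce
qed

abbreviation "tight_borel \<equiv> borel_of_top tight_topology"

lemma space_tight_borel: "space tight_borel = M1"
  by (simp add: borel_of_top_def space_measure_of_conv topspace_tight_topology)

lemma openin_in_tight_borel: "openin tight_topology U \<Longrightarrow> U \<in> sets tight_borel"
  unfolding borel_of_top_def by (rule in_measure_of) (auto dest: openin_subset)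

lemma integral_tight_measurable:
  assumes "continuous_on {0<..1} f" "bounded (f ` {0<..1})"
  shows "(\<lambda>P. \<integral>t. f t \<partial>P :: real) \<in> borel_measurable tight_borel"
proof (rule borel_measurableI)
  fix U :: "real set" assume "open U"
  have "(\<lambda>P. \<integral>t. f t \<partial>P) -` U \<inter> space tight_borel = {P \<in> M1. (\<integral>t. f t \<partial>P) \<in> U}"
    by (auto simp: space_tight_borel)
  then show "(\<lambda>P. \<integral>t. f t \<partial>P) -` U \<inter> space tight_borel \<in> sets tight_borel"
    using openin_in_tight_borel[OF tight_subbasic_open[OF assms \<open>open U\<close>]] by simp
qed

text \<open>Mass of an initial segment need not be tightly continuous, but it is a pointwise limit
  of integrals of continuous functions.\<close>

lemma measure_Ioc_tight_measurable: "(\<lambda>P. measure P ({0<..1} \<inter> {..c})) \<in> borel_measurable tight_borel"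
proof (rule borel_measurable_LIMSEQ_real)
  \<comment> \<open>For positive \<open>n\<close> this is a ramp: 1 up to \<open>c\<close>, linear
    in between, and 0 from \<open>c + 1 / n\<close> on.\<close>
  define h where "h n t = max 0 (1 - real n * max 0 (t - c))" for n t
  have h01: "0 \<le> h n t" "h n t \<le> 1" for n t
    by (simp_all add: h_def)
  have h_cont: "continuous_on A (h n)" for n A
    unfolding h_def by (intro continuous_intros)
  show "(\<lambda>P. \<integral>t. h n t \<partial>P) \<in> borel_measurable tight_borel" for n
    by (rule integral_tight_measurable[OF h_cont]) (auto simp: bounded_iff h01 intro!: exI[of _ 1])
  fix P assume "P \<in> space tight_borel"
  then have P: "P \<in> M1"
    by (simp add: space_tight_borel)
  interpret prob_space P by (rule M1D[OF P])
  have "(\<lambda>n. \<integral>t. h n t \<partial>P) \<longlonglongrightarrow> (\<integral>t. indicator {..c} t \<partial>P)"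
  proof (rule integral_dominated_convergence[where w = "\<lambda>_. 1"])
    have "(\<lambda>n. h n t) \<longlonglongrightarrow> indicator {..c} t" for t
    proof (cases "t \<le> c")
      case False
      then have "\<forall>\<^sub>F n in sequentially. 1 / (t - c) \<le> real n"
        by (intro eventually_sequentiallyI[of "nat \<lceil>1 / (t - c)\<rceil>"]) linarith
      then have "\<forall>\<^sub>F n in sequentially. h n t = 0"
        by eventually_elim (use False in \<open>simp add: h_def field_simps max_def\<close>)
      then show ?thesis
        using False by (simp add: tendsto_eventually)
    qed (simp add: h_def)
    then show "AE t in P. (\<lambda>n. h n t) \<longlonglongrightarrow> indicator {..c} t"
      by simp
    show "indicator {..c} \<in> borel_measurable P"
      by (rule unit_measurable_M1[OF P], unfold unit_borel_def) (auto intro: measurable_restrict_space1)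
    show "h n \<in> borel_measurable P" for n
      by (intro unit_measurable_M1[OF P] continuous_imp_unit_measurable h_cont)
  qed (auto simp: h01)
  then show "(\<lambda>n. \<integral>t. h n t \<partial>P) \<longlonglongrightarrow> measure P ({0<..1} \<inter> {..c})"
    by (simp add: M1D(2)[OF P] Int_commute)
qed

lemma hist_tight_measurable: "(\<lambda>P. hist P xs) \<in> borel_measurable tight_borel"
proof -
  define a b where "a = real (bin_val xs) / 2 ^ length xs" and "b = (real (bin_val xs) + 1) / 2 ^ length xs"
  have "hist P xs = measure P ({0<..1} \<inter> {..b}) - measure P ({0<..1} \<inter> {..a})" if P: "P \<in> M1" for P
  proof -
    interpret prob_space P by (rule M1D[OF P])
    have "{0<..1} \<inter> {..c} \<in> sets P" for c
      unfolding M1D(3)[OF P] by (rule sets_unit_borelI) auto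
    moreover have "a \<le> b"
      by (simp add: a_def b_def divide_right_mono)
    moreover have "dyadic_set xs = {0<..1} \<inter> {..b} - {0<..1} \<inter> {..a}"
      using dyadic_set_subset[of xs] unfolding dyadic_set_def a_def[symmetric] b_def[symmetric] by auto
    ultimately show ?thesis
      unfolding hist_def by (simp only:) (rule finite_measure_Diff, auto)
  qed
  then show ?thesis
    by (subst measurable_cong[of _ _ "\<lambda>P. measure P ({0<..1} \<inter> {..b}) - measure P ({0<..1} \<inter> {..a})"])
      (auto simp: space_tight_borel intro: measure_Ioc_tight_measurable borel_measurable_diff)
qed

lemma hist_fun_tight_measurable: "hist \<in> tight_borel \<rightarrow>\<^sub>M borel"
  using hist_tight_measurable by (intro measurable_coordinatewise_then_product)

text \<open>The decoding map; it is meaningful only on \<open>hist_set\<close>, the image of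
  \<open>hist\<close>.\<close>

definition measure_of_hist :: "(bool list \<Rightarrow> real) \<Rightarrow> real measure" where
  "measure_of_hist = inv_into M1 hist"

lemma measure_of_hist:
  "P \<in> M1 \<Longrightarrow> measure_of_hist (hist P) = P"
  "x \<in> hist_set \<Longrightarrow> hist (measure_of_hist x) = x"
  "x \<in> hist_set \<Longrightarrow> measure_of_hist x \<in> M1"
  unfolding measure_of_hist_def hist_image[symmetric]
  by (simp_all add: inv_into_f_f inj_on_hist f_inv_into_f inv_into_into)

text \<open>It suffices to test subbasic sets, and sequences suffice in the countable product.
  Coordinatewise convergence there is convergence of all dyadic masses, which forces convergence of
  the defining integrals.\<close>

lemma continuous_map_measure_of_hist:
  "continuous_map (top_of_set hist_set) tight_topology measure_of_hist"
  unfolding tight_topology_def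
proof (rule continuous_on_generated_topo)
  fix W assume "W \<in> {{P \<in> M1. (\<integral>x. f x \<partial>P) \<in> U} | f U.
        continuous_on {0<..1} f \<and> bounded (f ` {0<..1}) \<and> open (U :: real set)}"
  then obtain f U where W: "W = {P \<in> M1. (\<integral>t. f t \<partial>P) \<in> U}"
    and f: "continuous_on {0<..1} f" "bounded (f ` {0<..1})" and U: "open (U :: real set)"
    by blast
  have "continuous_on hist_set (\<lambda>x. \<integral>t. f t \<partial>measure_of_hist x)"
  proof (rule continuous_on_sequentiallyI)
    fix u and a :: "bool list \<Rightarrow> real"
    assume "\<forall>n. u n \<in> hist_set" "a \<in> hist_set" "u \<longlonglongrightarrow> a"
    then show "(\<lambda>n. \<integral>t. f t \<partial>measure_of_hist (u n)) \<longlonglongrightarrow> (\<integral>t. f t \<partial>measure_of_hist a)"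
      by (intro hist_converges_imp_integral_tendsto f)
        (auto simp: measure_of_hist intro: continuous_on_tendsto_compose[OF continuous_on_product_coordinates])
  qed
  then have "openin (top_of_set hist_set) (hist_set \<inter> (\<lambda>x. \<integral>t. f t \<partial>measure_of_hist x) -` U)"
    using U by (rule continuous_openin_preimage_gen)
  also have "hist_set \<inter> (\<lambda>x. \<integral>t. f t \<partial>measure_of_hist x) -` U =
      measure_of_hist -` W \<inter> topspace (top_of_set hist_set)"
    by (auto simp: W measure_of_hist)
  finally show "openin (top_of_set hist_set) (measure_of_hist -` W \<inter> topspace (top_of_set hist_set))" .
next
  have "M1 = \<Union>{{P \<in> M1. (\<integral>t. f t \<partial>P) \<in> U} | f U.
        continuous_on {0<..1} f \<and> bounded (f ` {0<..1}) \<and> open (U :: real set)}"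
    using topspace_tight_topology unfolding tight_topology_def topology_generated_by_topspace by simp
  then show "measure_of_hist ` topspace (top_of_set hist_set) \<subseteq> \<Union>{{P \<in> M1. (\<integral>t. f t \<partial>P) \<in> U} | f U.
        continuous_on {0<..1} f \<and> bounded (f ` {0<..1}) \<and> open (U :: real set)}"
    using measure_of_hist(3) by auto
qed

lemma hist_set_borel: "hist_set \<in> sets borel"
proof -
  have coord: "(\<lambda>x. x xs) \<in> borel_measurable borel" for xs :: "bool list"
    by (rule measurable_product_coordinates)
  have "hist_set = (\<Inter>xs. {x \<in> space borel. 0 \<le> x xs}) \<inter> {x \<in> space borel. x [] = 1} \<inter>
      (\<Inter>xs. {x \<in> space borel. x xs = x (xs @ [False]) + x (xs @ [True])}) \<inter>
      (\<Inter>xs. \<Inter>k. \<Union>n. {x \<in> space borel. x (xs @ replicate n False) < 1 / real (Suc k)})"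
    unfolding hist_set_def by (intro set_eqI) (simp only: Int_iff INT_iff UN_iff mem_Collect_eq space_borel UNIV_I, blast)
  also have "\<dots> \<in> sets borel"
    by (intro sets.Int sets.countable_INT'' sets.countable_UN'' borel_measurable_le borel_measurable_eq
        borel_measurable_less borel_measurable_add borel_measurable_const coord) simp_all
  finally show ?thesis .
qed

section \<open>Random histograms from beta splits\<close>

text \<open>The divisor \<open>c\<close> is kept free because the mean is computed with exponent
  \<open>a\<close> but the normalising constant \<open>Beta a b\<close>.\<close>

lemma has_integral_beta_density:
  fixes a b :: real
  assumes "a > 0" "b > 0"
  shows "((\<lambda>x. x powr (a - 1) * (1 - x) powr (b - 1) / c) has_integral Beta a b / c) {0<..<1}"
  using has_integral_divide[OF has_integral_Beta_real[OF assms], of c] by (simp add: has_integral_Icc_iff_Ioo)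

lemma Beta_real_pos: "a > 0 \<Longrightarrow> b > 0 \<Longrightarrow> Beta a b > 0" for a b :: real
  by (simp add: Beta_def)

lemma sets_beta_measure [simp, measurable_cong]: "sets (beta_measure a b) = sets borel"
  by (simp add: beta_measure_def)

lemma space_beta_measure [simp]: "space (beta_measure a b) = UNIV"
  by (simp add: beta_measure_def)

context
  fixes a b :: real
  assumes ab: "a > 0" "b > 0"
begin

lemma AE_beta_measure: "AE y in beta_measure a b. 0 < y \<and> y < 1"
  unfolding beta_measure_def by (subst AE_density) (auto simp: indicator_def)

lemma prob_space_beta_measure: "prob_space (beta_measure a b)"
proof (rule prob_spaceI)
  have "emeasure (beta_measure a b) UNIV =
      (\<integral>\<^sup>+x. ennreal (indicator {0<..<1} x * (x powr (a - 1) * (1 - x) powr (b - 1) / Beta a b)) \<partial>lborel)"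
    unfolding beta_measure_def by (subst emeasure_density) auto
  also have "\<dots> = ennreal (Beta a b / Beta a b)"
    using Beta_real_pos[OF ab]
    by (intro nn_integral_has_integral_lebesgue has_integral_beta_density ab) simp
  finally show "emeasure (beta_measure a b) (space (beta_measure a b)) = 1"
    using Beta_real_pos[OF ab] by simp
qed

interpretation B: prob_space "beta_measure a b"
  by (rule prob_space_beta_measure)

lemma integrable_beta_measure: "integrable (beta_measure a b) (\<lambda>y. y)"
  by (rule B.integrable_const_bound[of _ 1]) (use AE_beta_measure in auto)

text \<open>Multiplying the density by \<open>x\<close> raises the first parameter by one, so the
  mean is the ratio \<open>Beta (a + 1) b / Beta a b\<close>.\<close>

lemma integral_beta_measure: "(\<integral>y. y \<partial>beta_measure a b) = a / (a + b)"
proof -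
  have "(\<integral>\<^sup>+y. ennreal y \<partial>beta_measure a b) =
      (\<integral>\<^sup>+x. ennreal (indicator {0<..<1} x * (x powr (a - 1) * (1 - x) powr (b - 1) / Beta a b)) * ennreal x \<partial>lborel)"
    unfolding beta_measure_def by (subst nn_integral_density) auto
  also have "\<dots> = (\<integral>\<^sup>+x. ennreal (indicator {0<..<1} x * (x powr (a + 1 - 1) * (1 - x) powr (b - 1) / Beta a b)) \<partial>lborel)"
  proof (intro nn_integral_cong)
    fix x :: real
    have "x powr (a - 1) * x = x powr (a + 1 - 1)" if "0 < x"
      using that by (simp add: powr_diff)
    then show "ennreal (indicator {0<..<1} x * (x powr (a - 1) * (1 - x) powr (b - 1) / Beta a b)) * ennreal x =
        ennreal (indicator {0<..<1} x * (x powr (a + 1 - 1) * (1 - x) powr (b - 1) / Beta a b))"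
      by (auto simp: indicator_def ennreal_mult''[symmetric] simp del: add_diff_cancel_right' intro!: arg_cong[of _ _ ennreal])
  qed
  also have "\<dots> = ennreal (Beta (a + 1) b / Beta a b)"
    using ab Beta_real_pos[OF ab]
    by (intro nn_integral_has_integral_lebesgue has_integral_beta_density) simp_all
  also have "Beta (a + 1) b / Beta a b = a / (a + b)"
    using Beta_plus1_left[of a b] ab Beta_real_pos[OF ab] by (simp add: field_simps nonpos_Ints_def)
  finally have "(\<integral>\<^sup>+y. ennreal y \<partial>beta_measure a b) = ennreal (a / (a + b))" .
  then show ?thesis
    using ab AE_beta_measure by (subst integral_eq_nn_integral) auto
qed

lemma integral_beta_measure_compl: "(\<integral>y. 1 - y \<partial>beta_measure a b) = b / (a + b)"
  using ab B.prob_space by (simp add: integrable_beta_measure integral_beta_measure field_simps)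

end

section \<open>Path products of the splits and their means\<close>

definition path_prob :: "(bool list \<Rightarrow> real) \<Rightarrow> bool list \<Rightarrow> real" where
  "path_prob v xs = (\<Prod>l\<in>{1..length xs}. V_of v (take l xs))"

lemma path_prob_Nil [simp]: "path_prob v [] = 1"
  by (simp add: path_prob_def)

lemma path_prob_snoc [simp]: "path_prob v (xs @ [b]) = path_prob v xs * (if b then 1 - v xs else v xs)"
proof -
  have "path_prob v (xs @ [b]) = (\<Prod>l\<in>{1..length xs}. V_of v (take l (xs @ [b]))) * V_of v (xs @ [b])"
    by (simp add: path_prob_def)
  also have "(\<Prod>l\<in>{1..length xs}. V_of v (take l (xs @ [b]))) = path_prob v xs"
    unfolding path_prob_def by (intro prod.cong) auto
  finally show ?thesis
    by (simp add: V_of_def)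
qed

text \<open>In this form each factor depends on one split only, namely the one at a prefix of the
  string, which prepares the use of independence.\<close>

lemma path_prob_eq_prod:
  "path_prob v xs = (\<Prod>l<length xs. if xs ! l then 1 - v (take l xs) else v (take l xs))"
proof (induction xs rule: rev_induct)
  case (snoc b xs)
  have "(\<Prod>l<length xs. if (xs @ [b]) ! l then 1 - v (take l (xs @ [b])) else v (take l (xs @ [b]))) =
      (\<Prod>l<length xs. if xs ! l then 1 - v (take l xs) else v (take l xs))"
    by (intro prod.cong) (auto simp: nth_append)
  then show ?case
    using snoc by simp
qed simp

lemma path_prob_nonneg: "(\<And>xs. 0 \<le> v xs \<and> v xs \<le> 1) \<Longrightarrow> 0 \<le> path_prob v xs"
  by (induction xs rule: rev_induct) auto

lemma path_prob_le_1: "(\<And>xs. 0 \<le> v xs \<and> v xs \<le> 1) \<Longrightarrow> path_prob v xs \<le> 1"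
  by (induction xs rule: rev_induct) (auto intro!: mult_le_one path_prob_nonneg)

text \<open>One array \<open>path_prob v\<close> thus carries the histograms of all levels at
  once.\<close>

lemma hist_of_eq_path_prob: "hist_of m v = restrict (path_prob v) (strings m)"
  unfolding hist_of_def path_prob_def by (intro restrict_ext prod.cong) (auto simp: strings_def)

lemma hist_of_restrict: "hist_of m (restrict v {xs. length xs < m}) = hist_of m v"
  unfolding hist_of_def
proof (intro restrict_ext prod.cong refl)
  fix xs l assume "xs \<in> strings m" "l \<in> {1..m}"
  then have "length (butlast (take l xs)) < m"
    by (auto simp: strings_def)
  then show "V_of (restrict v {xs. length xs < m}) (take l xs) = V_of v (take l xs)"
    by (simp add: V_of_def)
qed

lemma finite_shorter_strings: "finite {xs :: bool list. length xs < m}"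
proof -
  have "{xs :: bool list. length xs < m} = (\<Union>n<m. strings n)"
    by (auto simp: strings_def)
  then show ?thesis
    by simp
qed

text \<open>The expected mass of a cell under independent beta splits, as
  \<open>integral_path_prob\<close> shows.\<close>

definition mean_path_prob :: "(bool list \<Rightarrow> real) \<Rightarrow> bool list \<Rightarrow> real" where
  "mean_path_prob \<beta> xs = (\<Prod>l<length xs. \<beta> (take l xs @ [xs ! l]) /
     (\<beta> (take l xs @ [False]) + \<beta> (take l xs @ [True])))"

lemma mean_path_prob_snoc:
  "mean_path_prob \<beta> (xs @ [b]) = mean_path_prob \<beta> xs * (\<beta> (xs @ [b]) / (\<beta> (xs @ [False]) + \<beta> (xs @ [True])))"
proof -
  have "(\<Prod>l<length xs. \<beta> (take l (xs @ [b]) @ [(xs @ [b]) ! l]) /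
      (\<beta> (take l (xs @ [b]) @ [False]) + \<beta> (take l (xs @ [b]) @ [True]))) = mean_path_prob \<beta> xs"
    unfolding mean_path_prob_def by (intro prod.cong) (auto simp: nth_append)
  then show ?thesis
    by (simp add: mean_path_prob_def[of \<beta> "xs @ [b]"])
qed

text \<open>The link with the theorem: the second factor is the partial product in its
  condition.\<close>

lemma mean_path_prob_zeros:
  "mean_path_prob \<beta> (xs @ replicate n False) = mean_path_prob \<beta> xs *
    (\<Prod>m<n. \<beta> (xs @ replicate m False @ [False]) /
        (\<beta> (xs @ replicate m False @ [False]) + \<beta> (xs @ replicate m False @ [True])))"
proof (induction n)
  case (Suc n)
  have "xs @ replicate (Suc n) False = (xs @ replicate n False) @ [False]"
    by (simp add: replicate_append_same)
  then show ?case
    using Suc mean_path_prob_snoc[of \<beta> "xs @ replicate n False" False]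
    by (simp only: prod.lessThan_Suc append_assoc mult.assoc)
qed simp

section \<open>The infinite product of the beta laws\<close>

context
  fixes \<beta> :: "bool list \<Rightarrow> real"
  assumes \<beta>_pos: "\<And>xs. xs \<noteq> [] \<Longrightarrow> \<beta> xs > 0"
begin

abbreviation split_law :: "bool list \<Rightarrow> real measure" where
  "split_law xs \<equiv> beta_measure (\<beta> (xs @ [False])) (\<beta> (xs @ [True]))"

abbreviation splits_law :: "(bool list \<Rightarrow> real) measure" where
  "splits_law \<equiv> PiM UNIV split_law"

lemma product_prob_space_split_law: "product_prob_space split_law"
  by (intro product_prob_spaceI prob_space_beta_measure \<beta>_pos) simp_all

interpretation product_prob_space split_law UNIV
  by (rule product_prob_space_split_law)

lemma path_prob_measurable: "(\<lambda>v. path_prob v xs) \<in> borel_measurable splits_law"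
proof (induction xs rule: rev_induct)
  case (snoc b xs)
  have [measurable]: "(\<lambda>v. v xs) \<in> borel_measurable splits_law"
    using measurable_component_singleton[of xs UNIV split_law] by (simp cong: measurable_cong_sets)
  note snoc [measurable]
  show ?case
    by (cases b) simp_all
qed simp

lemma path_prob_fun_measurable: "path_prob \<in> splits_law \<rightarrow>\<^sub>M borel"
  using path_prob_measurable by (rule measurable_coordinatewise_then_product)

lemma restrict_path_prob_measurable:
  "(\<lambda>v. restrict (path_prob v) A) \<in> splits_law \<rightarrow>\<^sub>M PiM A (\<lambda>_. borel)"
  by (intro measurable_restrict path_prob_measurable)

lemma hist_of_measurable:
  "hist_of m \<in> PiM {xs. length xs < m} split_law \<rightarrow>\<^sub>M PiM (strings m) (\<lambda>_. borel)"
  unfolding hist_of_def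
proof (intro measurable_restrict borel_measurable_prod)
  fix xs l assume "xs \<in> strings m" "l \<in> {1..m}"
  then have "butlast (take l xs) \<in> {xs. length xs < m}"
    by (auto simp: strings_def)
  from measurable_component_singleton[OF this, of split_law]
  have [measurable]: "(\<lambda>v. v (butlast (take l xs))) \<in> borel_measurable (PiM {xs. length xs < m} split_law)"
    by (simp cong: measurable_cong_sets)
  show "(\<lambda>v. V_of v (take l xs)) \<in> borel_measurable (PiM {xs. length xs < m} split_law)"
    unfolding V_of_def by (cases "last (take l xs)") simp_all
qed

text \<open>A level \<open>m\<close> histogram uses only splits at strings shorter than
  \<open>m\<close>, and the marginal of the infinite product on these is the finite product in
  \<open>polya_hist\<close>.\<close>

lemma distr_path_prob: "distr splits_law (PiM (strings m) (\<lambda>_. borel)) (\<lambda>v. restrict (path_prob v) (strings m)) = polya_hist \<beta> m"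
proof -
  let ?J = "{xs :: bool list. length xs < m}"
  have "polya_hist \<beta> m = distr (distr splits_law (PiM ?J split_law) (\<lambda>v. restrict v ?J)) (PiM (strings m) (\<lambda>_. borel)) (hist_of m)"
    unfolding polya_hist_def by (subst distr_PiM_restrict_finite[OF finite_shorter_strings]) auto
  also have "\<dots> = distr splits_law (PiM (strings m) (\<lambda>_. borel)) (hist_of m \<circ> (\<lambda>v. restrict v ?J))"
    by (intro distr_distr hist_of_measurable measurable_restrict_subset) simp
  also have "hist_of m \<circ> (\<lambda>v. restrict v ?J) = (\<lambda>v. restrict (path_prob v) (strings m))"
    by (simp only: comp_def hist_of_restrict hist_of_eq_path_prob[symmetric])
  finally show ?thesis ..
qed

lemma AE_splits_law: "AE v in splits_law. \<forall>xs. 0 \<le> v xs \<and> v xs \<le> 1"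
proof (subst AE_all_countable, rule allI)
  fix xs
  have "AE y in split_law xs. 0 \<le> y \<and> y \<le> 1"
    using AE_beta_measure[of "\<beta> (xs @ [False])" "\<beta> (xs @ [True])"] \<beta>_pos by auto
  then show "AE v in splits_law. 0 \<le> v xs \<and> v xs \<le> 1"
    by (intro AE_component) simp
qed

text \<open>Distinct prefixes of \<open>xs\<close> index independent splits, so the expectation of
  the product factorises into beta means.\<close>

lemma integral_path_prob: "(\<integral>v. path_prob v xs \<partial>splits_law) = mean_path_prob \<beta> xs"
proof -
  define J where "J = (\<lambda>l. take l xs) ` {..<length xs}"
  \<comment> \<open>Factors are indexed by the prefix \<open>i\<close> itself; the bit
    \<open>xs ! length i\<close> is the direction in which \<open>xs\<close> leaves it.\<close>
  define g where "g i y = (if xs ! length i then 1 - y else y)" for i :: "bool list" and y :: real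
  have inj: "inj_on (\<lambda>l. take l xs) {..<length xs}"
    by (rule inj_onI) (metis length_take lessThan_iff min.absorb4)
  have prod: "path_prob v xs = (\<Prod>i\<in>J. g i (v i))" for v
    unfolding path_prob_eq_prod J_def prod.reindex[OF inj] by (intro prod.cong) (auto simp: g_def)
  have g_int: "integrable (split_law i) (g i)" for i
  proof -
    interpret prob_space "split_law i"
      using \<beta>_pos by (intro prob_space_beta_measure) simp_all
    show ?thesis
      using integrable_beta_measure[of "\<beta> (i @ [False])" "\<beta> (i @ [True])"] \<beta>_pos
      by (cases "xs ! length i") (simp_all add: g_def[abs_def])
  qed
  have g_integral: "(\<integral>y. g i y \<partial>split_law i) =
      \<beta> (i @ [xs ! length i]) / (\<beta> (i @ [False]) + \<beta> (i @ [True]))" for i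
    using integral_beta_measure[of "\<beta> (i @ [False])" "\<beta> (i @ [True])"]
      integral_beta_measure_compl[of "\<beta> (i @ [False])" "\<beta> (i @ [True])"] \<beta>_pos
    by (cases "xs ! length i") (simp_all only: g_def if_True if_False, simp_all)
  have g_meas: "(\<lambda>v. \<Prod>i\<in>J. g i (v i)) \<in> borel_measurable (PiM J split_law)"
  proof (intro borel_measurable_prod)
    fix i assume "i \<in> J"
    from measurable_component_singleton[OF this, of split_law]
    have [measurable]: "(\<lambda>v. v i) \<in> borel_measurable (PiM J split_law)"
      by (simp cong: measurable_cong_sets)
    show "(\<lambda>v. g i (v i)) \<in> borel_measurable (PiM J split_law)"
      unfolding g_def by (cases "xs ! length i") simp_all
  qed
  have "finite J"
    by (simp add: J_def)
  have "(\<integral>v. path_prob v xs \<partial>splits_law) = (\<integral>v. (\<Prod>i\<in>J. g i (restrict v J i)) \<partial>splits_law)"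
    unfolding prod by (intro Bochner_Integration.integral_cong prod.cong) auto
  also have "\<dots> = (\<integral>v. (\<Prod>i\<in>J. g i (v i)) \<partial>distr splits_law (PiM J split_law) (\<lambda>v. restrict v J))"
    by (intro integral_distr[symmetric] measurable_restrict_subset g_meas) simp
  also have "\<dots> = (\<integral>v. (\<Prod>i\<in>J. g i (v i)) \<partial>PiM J split_law)"
    by (subst distr_PiM_restrict_finite[OF \<open>finite J\<close>]) auto
  also have "\<dots> = (\<Prod>i\<in>J. \<integral>y. g i y \<partial>split_law i)"
    by (rule product_integral_prod[OF \<open>finite J\<close> g_int])
  also have "\<dots> = mean_path_prob \<beta> xs"
    unfolding mean_path_prob_def J_def prod.reindex[OF inj]
    by (intro prod.cong) (auto simp: g_integral)
  finally show ?thesis .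
qed

lemma mean_path_prob_pos: "0 < mean_path_prob \<beta> xs"
  unfolding mean_path_prob_def by (intro prod_pos divide_pos_pos add_pos_pos ballI \<beta>_pos) simp_all

text \<open>Markov's inequality: on the event \<open>B\<close> that the path products never fall
  below \<open>c\<close>, each of them is at least \<open>c\<close>, so \<open>c\<close> times the
  probability of \<open>B\<close> is bounded by means that tend to 0.\<close>

lemma AE_path_prob_zeros_small:
  assumes lim: "(\<lambda>n. mean_path_prob \<beta> (xs @ replicate n False)) \<longlonglongrightarrow> 0" and "c > 0"
  shows "AE v in splits_law. \<exists>n. path_prob v (xs @ replicate n False) < c"
proof -
  define B where "B = {v \<in> space splits_law. \<forall>n. c \<le> path_prob v (xs @ replicate n False)}"
  note path_prob_measurable [measurable]
  have B [measurable]: "B \<in> sets splits_law"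
    unfolding B_def by measurable
  have "c * P.prob B \<le> mean_path_prob \<beta> (xs @ replicate n False)" for n
  proof -
    have "c * P.prob B = (\<integral>v. c * indicator B v \<partial>splits_law)"
      using B by (simp add: Int_absorb2 sets.sets_into_space)
    also have "\<dots> \<le> (\<integral>v. path_prob v (xs @ replicate n False) \<partial>splits_law)"
    proof (rule integral_mono_AE)
      show "integrable splits_law (\<lambda>v. c * indicator B v)"
        by (simp add: P.emeasure_eq_measure)
      have "AE v in splits_law. \<bar>path_prob v (xs @ replicate n False)\<bar> \<le> 1"
        using AE_splits_law by eventually_elim (simp add: path_prob_nonneg path_prob_le_1)
      then show "integrable splits_law (\<lambda>v. path_prob v (xs @ replicate n False))"
        by (intro P.integrable_const_bound[of _ 1]) auto
      show "AE v in splits_law. c * indicator B v \<le> path_prob v (xs @ replicate n False)"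
        using AE_splits_law by eventually_elim (auto simp: indicator_def B_def path_prob_nonneg)
    qed
    finally show ?thesis
      by (simp add: integral_path_prob)
  qed
  then have "c * P.prob B \<le> 0"
    using lim by (intro LIMSEQ_le_const) auto
  then have "P.prob B = 0"
    using \<open>c > 0\<close> by (simp add: mult_le_0_iff measure_le_0_iff)
  then show ?thesis
    unfolding B_def by (subst (asm) P.prob_Collect_eq_0) (auto simp: not_le)
qed

text \<open>Total mass and additivity hold for all splits, and nonnegativity for splits in [0,1].
  The smallness clause ranges over countably many pairs of a string and \<open>k\<close>, so the
  null sets can be united.\<close>

lemma AE_path_prob_in_hist_set:
  assumes "\<And>xs. (\<lambda>n. mean_path_prob \<beta> (xs @ replicate n False)) \<longlonglongrightarrow> 0"
  shows "AE v in splits_law. path_prob v \<in> hist_set"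
proof -
  have "AE v in splits_law. \<forall>xs k. \<exists>n. path_prob v (xs @ replicate n False) < 1 / real (Suc k)"
    by (simp only: AE_all_countable) (intro allI AE_path_prob_zeros_small assms, simp)
  with AE_splits_law show ?thesis
  proof eventually_elim
    case (elim v)
    then show ?case
      unfolding hist_set_def by (auto simp: path_prob_nonneg algebra_simps)
  qed
qed

end

section \<open>Borel probabilities on the space of measures\<close>

lemma measure_of_hist_measurable:
  "measure_of_hist \<in> restrict_space borel hist_set \<rightarrow>\<^sub>M tight_borel"
  unfolding borel_of_top_def
proof (rule measurable_measure_of)
  show "measure_of_hist \<in> space (restrict_space borel hist_set) \<rightarrow> topspace tight_topology"
    by (auto simp: space_restrict_space topspace_tight_topology measure_of_hist)
  fix U assume "U \<in> {U. openin tight_topology U}"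
  then have "openin (top_of_set hist_set) {x \<in> topspace (top_of_set hist_set). measure_of_hist x \<in> U}"
    by (intro openin_continuous_map_preimage[OF continuous_map_measure_of_hist]) simp
  then obtain W where "open W" "{x \<in> hist_set. measure_of_hist x \<in> U} = hist_set \<inter> W"
    by (auto simp: openin_open)
  moreover have "measure_of_hist -` U \<inter> space (restrict_space borel hist_set) = {x \<in> hist_set. measure_of_hist x \<in> U}"
    by (auto simp: space_restrict_space)
  ultimately show "measure_of_hist -` U \<inter> space (restrict_space borel hist_set) \<in> sets (restrict_space borel hist_set)"
    by (auto simp: sets_restrict_space)
qed (auto dest: openin_subset)

text \<open>This set is the image of \<open>B\<close> under \<open>hist\<close>. It is Borel in the
  whole function space because \<open>hist_set\<close> is.\<close>

lemma measure_of_hist_vimage_borel: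
  assumes "B \<in> sets tight_borel"
  shows "hist_set \<inter> measure_of_hist -` B \<in> sets borel"
  using measurable_sets[OF measure_of_hist_measurable assms] hist_set_borel
  by (simp add: sets_restrict_space_iff space_restrict_space Int_commute)

lemma hist_measurable_of_sets: "sets \<mu> = sets tight_borel \<Longrightarrow> hist \<in> \<mu> \<rightarrow>\<^sub>M borel"
  using hist_fun_tight_measurable by (simp cong: measurable_cong_sets)

lemma space_of_sets_tight_borel: "sets \<mu> = sets tight_borel \<Longrightarrow> space \<mu> = M1"
  using sets_eq_imp_space_eq[of \<mu> tight_borel] by (simp add: space_tight_borel)

text \<open>Since \<open>hist\<close> is injective, no information is lost in passing to the image
  law. Regularity and uniqueness are both transferred along this identity.\<close>

lemma emeasure_eq_emeasure_distr_hist: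
  assumes \<mu>: "sets \<mu> = sets tight_borel" and B: "B \<in> sets tight_borel"
  shows "emeasure \<mu> B = emeasure (distr \<mu> borel hist) (hist_set \<inter> measure_of_hist -` B)"
proof -
  have "B \<subseteq> M1"
    using sets.sets_into_space[OF B] by (simp add: space_tight_borel)
  then have "hist -` (hist_set \<inter> measure_of_hist -` B) \<inter> space \<mu> = B"
    using hist_in_hist_set by (auto simp: space_of_sets_tight_borel[OF \<mu>] measure_of_hist)
  then show ?thesis
    by (subst emeasure_distr) (simp_all add: hist_measurable_of_sets[OF \<mu>] measure_of_hist_vimage_borel[OF B])
qed

text \<open>The inverse of \<^term>\<open>hist\<close> is continuous, so compact sets of histograms yield compact sets of measures.\<close>

lemma radon_prob_tight_topology:
  assumes "prob_space \<mu>" and \<mu>: "sets \<mu> = sets tight_borel"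
  shows "radon_prob tight_topology \<mu>"
  unfolding radon_prob_def
proof (intro conjI ballI assms)
  interpret prob_space \<mu> by fact
  let ?\<nu> = "distr \<mu> borel hist"
  interpret \<nu>: prob_space ?\<nu>
    by (rule prob_space_distr[OF hist_measurable_of_sets[OF \<mu>]])
  fix B assume B: "B \<in> sets \<mu>"
  define C where "C = hist_set \<inter> measure_of_hist -` B"
  have B_sub: "B \<subseteq> M1"
    using sets.sets_into_space[OF B] by (simp add: space_of_sets_tight_borel[OF \<mu>])
  have "emeasure \<mu> B = emeasure ?\<nu> C"
    unfolding C_def using B by (intro emeasure_eq_emeasure_distr_hist) (simp_all add: \<mu>)
  \<comment> \<open>Finite Borel measures on the Polish space of real functions on strings are inner
    regular by compact sets.\<close>
  also have "\<dots> = (SUP K \<in> {K. K \<subseteq> C \<and> compact K}. emeasure ?\<nu> K)"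
    using B measure_of_hist_vimage_borel[of B] unfolding C_def
    by (intro inner_regular) (simp_all add: \<mu> \<nu>.emeasure_eq_measure)
  also have "\<dots> \<le> (SUP K \<in> {K. compactin tight_topology K \<and> K \<subseteq> B \<and> K \<in> sets \<mu>}. emeasure \<mu> K)"
  proof (rule SUP_least)
    fix K assume "K \<in> {K. K \<subseteq> C \<and> compact K}"
    then have K: "K \<subseteq> C" "compact K" by auto
    have "compactin (top_of_set hist_set) K"
      using K by (auto simp: compactin_subtopology C_def)
    then have "compactin tight_topology (measure_of_hist ` K)"
      by (rule image_compactin) (rule continuous_map_measure_of_hist)
    moreover have "measure_of_hist ` K \<subseteq> B"
      using K by (auto simp: C_def)
    \<comment> \<open>As \<open>hist\<close> inverts the decoding on \<open>K\<close>, the compact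
      image is also a preimage under \<open>hist\<close>; hence it is measurable and has the mass of
      \<open>K\<close>.\<close>
    moreover have vimage: "measure_of_hist ` K = hist -` K \<inter> space \<mu>"
      using K by (force simp: C_def space_of_sets_tight_borel[OF \<mu>] measure_of_hist image_iff)
    moreover have "hist -` K \<inter> space \<mu> \<in> sets \<mu>"
      using K by (intro measurable_sets[OF hist_measurable_of_sets[OF \<mu>]]) (simp add: borel_compact)
    moreover have "emeasure ?\<nu> K = emeasure \<mu> (hist -` K \<inter> space \<mu>)"
      using K by (intro emeasure_distr hist_measurable_of_sets \<mu>) (simp add: borel_compact)
    ultimately show "emeasure ?\<nu> K \<le> (SUP K \<in> {K. compactin tight_topology K \<and> K \<subseteq> B \<and> K \<in> sets \<mu>}. emeasure \<mu> K)"
      by (intro SUP_upper2[of "measure_of_hist ` K"]) simp_all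
  qed
  finally show "emeasure \<mu> B = (SUP K \<in> {K. compactin tight_topology K \<and> K \<subseteq> B \<and> K \<in> sets \<mu>}. emeasure \<mu> K)"
    using B by (intro antisym) (auto intro!: SUP_least emeasure_mono)
qed

section \<open>Uniqueness from the finite histograms\<close>

lemma proj_hist_eq: "proj_hist m P = restrict (hist P) (strings m)"
  by (simp add: proj_hist_def hist_def restrict_def fun_eq_iff)

lemma proj_hist_measurable:
  assumes "sets \<mu> = sets tight_borel"
  shows "proj_hist m \<in> \<mu> \<rightarrow>\<^sub>M PiM (strings m) (\<lambda>_. borel)"
proof -
  have "proj_hist m \<in> tight_borel \<rightarrow>\<^sub>M PiM (strings m) (\<lambda>_. borel)"
    unfolding proj_hist_eq[abs_def] by (intro measurable_restrict hist_tight_measurable)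
  then show ?thesis
    using assms by (simp cong: measurable_cong_sets)
qed

text \<open>Iterated additivity. It lets entries of several levels be read off from one common
  deeper level.\<close>

lemma hist_set_sum_descendants:
  assumes "x \<in> hist_set"
  shows "x xs = (\<Sum>ys\<in>strings (length xs + n). if take (length xs) ys = xs then x ys else 0)"
proof (induction n)
  case 0
  have "(\<Sum>ys\<in>strings (length xs). if take (length xs) ys = xs then x ys else 0) =
      (\<Sum>ys\<in>strings (length xs). if ys = xs then x ys else 0)"
    by (intro sum.cong) (auto simp: strings_def)
  moreover have "xs \<in> strings (length xs)"
    by (simp add: strings_def)
  ultimately show ?case
    by simp
next
  case (Suc n)
  have "(\<Sum>ys\<in>strings (length xs + n). if take (length xs) ys = xs then x ys else 0) =
      (\<Sum>ys\<in>strings (Suc (length xs + n)). if take (length xs) ys = xs then x ys else 0)"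
    unfolding sum_strings_Suc
  proof (intro sum.cong refl)
    fix ys assume "ys \<in> strings (length xs + n)"
    then have "take (length xs) (ys @ [b]) = take (length xs) ys" for b
      by (simp add: strings_def)
    then show "(if take (length xs) ys = xs then x ys else 0) =
        (if take (length xs) (ys @ [False]) = xs then x (ys @ [False]) else 0) +
        (if take (length xs) (ys @ [True]) = xs then x (ys @ [True]) else 0)"
      using hist_set_split[OF assms, of ys] by simp
  qed
  then show ?case
    using Suc by simp
qed

text \<open>The laws of \<open>hist\<close> agree on cylinders over finitely many strings, since
  these are determined by a single histogram; cylinders generate the Borel sets of the countable
  product, and \<open>hist\<close> loses no information.\<close>

lemma borel_prob_unique:
  assumes "prob_space \<mu>" and \<mu>: "sets \<mu> = sets tight_borel" and \<nu>: "sets \<nu> = sets tight_borel"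
    and eq: "\<And>m. distr \<mu> (PiM (strings m) (\<lambda>_. borel)) (proj_hist m) = distr \<nu> (PiM (strings m) (\<lambda>_. borel)) (proj_hist m)"
  shows "\<mu> = \<nu>"
proof -
  interpret prob_space \<mu> by fact
  have "distr \<mu> borel hist = distr \<nu> borel hist"
  proof (rule measure_eqI_PiM_infinite[where I = UNIV and M = "\<lambda>_. borel"])
    show "finite_measure (distr \<mu> borel hist)"
      by (intro finite_measure_distr hist_measurable_of_sets \<mu>)
    fix A and J :: "bool list set"
    assume J: "finite J" and A: "\<And>i. i \<in> J \<Longrightarrow> A i \<in> sets (borel :: real measure)"
    \<comment> \<open>A level at least as deep as every string in \<open>J\<close>; inserting 0
      covers empty \<open>J\<close>.\<close>
    define N where "N = Max (insert 0 (length ` J))"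
    define X where "X = {x \<in> space (PiM (strings N) (\<lambda>_. borel :: real measure)).
        \<forall>j\<in>J. (\<Sum>ys\<in>strings N. if take (length j) ys = j then x ys else 0) \<in> A j}"
    have N: "length j \<le> N" if "j \<in> J" for j
      using that J by (simp add: N_def)
    have X: "X \<in> sets (PiM (strings N) (\<lambda>_. borel))"
      unfolding X_def
    proof (rule sets.sets_Collect_finite_All[OF _ J])
      fix j assume "j \<in> J"
      have "(\<lambda>x. \<Sum>ys\<in>strings N. if take (length j) ys = j then x ys else 0)
          \<in> borel_measurable (PiM (strings N) (\<lambda>_. borel :: real measure))"
        by (intro borel_measurable_sum) (auto intro!: measurable_component_singleton)
      from measurable_sets_Collect[OF this, of "\<lambda>y. y \<in> A j"] A[OF \<open>j \<in> J\<close>]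
      show "{x \<in> space (PiM (strings N) (\<lambda>_. borel :: real measure)).
          (\<Sum>ys\<in>strings N. if take (length j) ys = j then x ys else 0) \<in> A j}
          \<in> sets (PiM (strings N) (\<lambda>_. borel))"
        by simp
    qed
    \<comment> \<open>Each coordinate in \<open>J\<close> is a sum of level \<open>N\<close>
      entries, so the cylinder is a condition on the level \<open>N\<close> histogram.\<close>
    have *: "hist P \<in> prod_emb UNIV (\<lambda>_. borel) J (Pi\<^sub>E J A) \<longleftrightarrow> proj_hist N P \<in> X" if "P \<in> M1" for P
    proof -
      have "hist P j = (\<Sum>ys\<in>strings N. if take (length j) ys = j then proj_hist N P ys else 0)" if "j \<in> J" for j
        using hist_set_sum_descendants[OF hist_in_hist_set[OF \<open>P \<in> M1\<close>], of j "N - length j"] N[OF that]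
        by (simp add: proj_hist_eq cong: sum.cong if_cong)
      moreover have "proj_hist N P \<in> space (PiM (strings N) (\<lambda>_. borel))"
        by (simp add: space_PiM proj_hist_eq)
      ultimately show ?thesis
        by (simp add: prod_emb_def X_def restrict_PiE_iff Pi_iff)
    qed
    have "emeasure (distr \<rho> borel hist) (prod_emb UNIV (\<lambda>_. borel) J (Pi\<^sub>E J A)) =
        emeasure (distr \<rho> (PiM (strings N) (\<lambda>_. borel)) (proj_hist N)) X"
      if \<rho>: "sets \<rho> = sets tight_borel" for \<rho>
    proof -
      have "prod_emb UNIV (\<lambda>_. borel) J (Pi\<^sub>E J A) \<in> sets (PiM UNIV (\<lambda>_. borel))"
        using J A by (intro sets_PiM_I) auto
      then have "prod_emb UNIV (\<lambda>_. borel) J (Pi\<^sub>E J A) \<in> sets borel"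
        by (simp add: sets_PiM_equal_borel)
      moreover have "hist -` prod_emb UNIV (\<lambda>_. borel) J (Pi\<^sub>E J A) \<inter> space \<rho> = proj_hist N -` X \<inter> space \<rho>"
        using * by (auto simp: space_of_sets_tight_borel[OF \<rho>])
      ultimately show ?thesis
        using X by (simp add: emeasure_distr hist_measurable_of_sets[OF \<rho>] proj_hist_measurable[OF \<rho>])
    qed
    then show "emeasure (distr \<mu> borel hist) (prod_emb UNIV (\<lambda>_. borel) J (Pi\<^sub>E J A)) =
        emeasure (distr \<nu> borel hist) (prod_emb UNIV (\<lambda>_. borel) J (Pi\<^sub>E J A))"
      by (simp only: \<mu> \<nu> eq)
  qed (simp_all add: sets_PiM_equal_borel)
  then show ?thesis
    by (intro measure_eqI) (simp_all add: \<mu> \<nu> emeasure_eq_emeasure_distr_hist)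
qed

section \<open>Necessity of the condition and existence of the law\<close>

context
  fixes \<beta> :: "bool list \<Rightarrow> real"
  assumes \<beta>_pos: "\<And>xs. xs \<noteq> [] \<Longrightarrow> \<beta> xs > 0"
begin

text \<open>The mean of one entry depends only on the histogram law of its level, so it can be
  computed with the product of beta laws instead of \<open>\<mu>\<close>.\<close>

lemma projects_imp_integral_hist:
  assumes \<mu>: "sets \<mu> = sets tight_borel" and "projects_to_polya \<beta> \<mu>"
  shows "(\<integral>P. hist P xs \<partial>\<mu>) = mean_path_prob \<beta> xs"
proof -
  let ?m = "length xs"
  let ?S = "PiM (strings ?m) (\<lambda>_. borel :: real measure)"
  have xs: "xs \<in> strings ?m"
    by (simp add: strings_def)
  have comp: "(\<lambda>x. x xs) \<in> borel_measurable ?S"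
    by (rule measurable_component_singleton[OF xs])
  have "(\<integral>P. hist P xs \<partial>\<mu>) = (\<integral>P. proj_hist ?m P xs \<partial>\<mu>)"
    using xs by (simp add: proj_hist_eq)
  also have "\<dots> = (\<integral>x. x xs \<partial>distr \<mu> ?S (proj_hist ?m))"
    by (rule integral_distr[symmetric, OF proj_hist_measurable[OF \<mu>] comp])
  also have "distr \<mu> ?S (proj_hist ?m) = polya_hist \<beta> ?m"
    using assms by (simp add: projects_to_polya_def)
  also have "\<dots> = distr (splits_law \<beta>) ?S (\<lambda>v. restrict (path_prob v) (strings ?m))"
    by (rule distr_path_prob[OF \<beta>_pos, symmetric])
  also have "(\<integral>x. x xs \<partial>\<dots>) = (\<integral>v. restrict (path_prob v) (strings ?m) xs \<partial>splits_law \<beta>)"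
    by (rule integral_distr[OF restrict_path_prob_measurable[OF \<beta>_pos] comp])
  also have "\<dots> = mean_path_prob \<beta> xs"
    using xs integral_path_prob[of \<beta> xs] \<beta>_pos by simp
  finally show ?thesis .
qed

text \<open>Every measure in \<open>M1\<close> has vanishing masses along appended zeros; dominated
  convergence with bound 1 passes this to the means.\<close>

lemma projects_imp_mean_tendsto_0:
  assumes "prob_space \<mu>" and \<mu>: "sets \<mu> = sets tight_borel" and "projects_to_polya \<beta> \<mu>"
  shows "(\<lambda>n. mean_path_prob \<beta> (xs @ replicate n False)) \<longlonglongrightarrow> 0"
proof -
  interpret prob_space \<mu> by fact
  have hist_meas: "(\<lambda>P. hist P ys) \<in> borel_measurable \<mu>" for ys
    using hist_tight_measurable \<mu> by (simp cong: measurable_cong_sets)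
  have "(\<lambda>n. \<integral>P. hist P (xs @ replicate n False) \<partial>\<mu>) \<longlonglongrightarrow> (\<integral>P. 0 \<partial>\<mu>)"
  proof (rule integral_dominated_convergence[where w = "\<lambda>_. 1"])
    show "AE P in \<mu>. (\<lambda>n. hist P (xs @ replicate n False)) \<longlonglongrightarrow> 0"
      by (intro AE_I2 hist_zeros_tendsto_0) (simp add: space_of_sets_tight_borel[OF \<mu>])
    show "AE P in \<mu>. norm (hist P (xs @ replicate n False)) \<le> 1" for n
    proof (intro AE_I2)
      fix P assume "P \<in> space \<mu>"
      then interpret P: prob_space P
        by (simp add: space_of_sets_tight_borel[OF \<mu>] M1D)
      show "norm (hist P (xs @ replicate n False)) \<le> 1"
        by (simp add: hist_def)
    qed
  qed (simp_all add: hist_meas)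
  then show ?thesis
    using assms by (simp add: projects_imp_integral_hist)
qed

text \<open>The law is the image of the infinite beta product under the path products followed by
  decoding.\<close>

lemma polya_tree_law_exists:
  assumes lim: "\<And>xs. (\<lambda>n. mean_path_prob \<beta> (xs @ replicate n False)) \<longlonglongrightarrow> 0"
  shows "\<exists>\<mu>. prob_space \<mu> \<and> sets \<mu> = sets tight_borel \<and> projects_to_polya \<beta> \<mu>"
proof -
  interpret product_prob_space "split_law \<beta>" UNIV
    by (rule product_prob_space_split_law[OF \<beta>_pos])
  have AE: "AE v in splits_law \<beta>. path_prob v \<in> hist_set"
    by (rule AE_path_prob_in_hist_set[OF \<beta>_pos lim])
  have "\<exists>v. path_prob v \<in> hist_set"
  proof (rule ccontr)
    assume "\<nexists>v. path_prob v \<in> hist_set"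
    with AE show False
      by simp
  qed
  then obtain v0 where "path_prob v0 \<in> hist_set"
    by blast
  \<comment> \<open>On the null set where the path products are not admissible a fixed admissible
    array is substituted, so that decoding applies everywhere and the law is unchanged.\<close>
  define g where "g v = (if path_prob v \<in> hist_set then path_prob v else path_prob v0)" for v
  have g: "g v \<in> hist_set" for v
    using \<open>path_prob v0 \<in> hist_set\<close> by (simp add: g_def)
  have "path_prob -` hist_set \<inter> space (splits_law \<beta>) \<in> sets (splits_law \<beta>)"
    by (rule measurable_sets[OF path_prob_fun_measurable[OF \<beta>_pos] hist_set_borel])
  also have "path_prob -` hist_set \<inter> space (splits_law \<beta>) = {v \<in> space (splits_law \<beta>). path_prob v \<in> hist_set}"
    by auto
  finally have "g \<in> splits_law \<beta> \<rightarrow>\<^sub>M borel"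
    unfolding g_def by (intro measurable_If path_prob_fun_measurable[OF \<beta>_pos]) simp_all
  then have "g \<in> splits_law \<beta> \<rightarrow>\<^sub>M restrict_space borel hist_set"
    using g by (intro measurable_restrict_space2) auto
  then have mg: "measure_of_hist \<circ> g \<in> splits_law \<beta> \<rightarrow>\<^sub>M tight_borel"
    by (rule measurable_comp[OF _ measure_of_hist_measurable])
  define \<mu> where "\<mu> = distr (splits_law \<beta>) tight_borel (measure_of_hist \<circ> g)"
  have "prob_space \<mu>"
    unfolding \<mu>_def by (rule P.prob_space_distr[OF mg])
  moreover have sets: "sets \<mu> = sets tight_borel"
    by (simp add: \<mu>_def)
  moreover have "distr \<mu> (PiM (strings m) (\<lambda>_. borel)) (proj_hist m) = polya_hist \<beta> m" for m
  proof -
    have "distr \<mu> (PiM (strings m) (\<lambda>_. borel)) (proj_hist m) =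
        distr (splits_law \<beta>) (PiM (strings m) (\<lambda>_. borel)) (proj_hist m \<circ> (measure_of_hist \<circ> g))"
      unfolding \<mu>_def by (rule distr_distr[OF proj_hist_measurable[OF refl] mg])
    also have "\<dots> = distr (splits_law \<beta>) (PiM (strings m) (\<lambda>_. borel)) (\<lambda>v. restrict (path_prob v) (strings m))"
    proof (rule distr_cong_AE)
      show "AE v in splits_law \<beta>. (proj_hist m \<circ> (measure_of_hist \<circ> g)) v = restrict (path_prob v) (strings m)"
        using AE by eventually_elim (simp add: proj_hist_eq g_def measure_of_hist)
      show "(\<lambda>v. restrict (path_prob v) (strings m)) \<in> splits_law \<beta> \<rightarrow>\<^sub>M PiM (strings m) (\<lambda>_. borel)"
        by (rule restrict_path_prob_measurable[OF \<beta>_pos])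
    qed (simp_all add: measurable_comp[OF mg proj_hist_measurable[OF refl]])
    also have "\<dots> = polya_hist \<beta> m"
      by (rule distr_path_prob[OF \<beta>_pos])
    finally show ?thesis .
  qed
  ultimately show ?thesis
    unfolding projects_to_polya_def by blast
qed

end

theorem mainTheorem15:
  fixes \<beta> :: "bool list \<Rightarrow> real"
  assumes "\<And>eps. eps \<noteq> [] \<Longrightarrow> \<beta> eps > 0"
  shows "(\<exists>!\<mu>. radon_prob tight_topology \<mu> \<and> projects_to_polya \<beta> \<mu>) \<longleftrightarrow>
    (\<forall>eps. (\<lambda>n. \<Prod>m<n. \<beta> (eps @ replicate m False @ [False]) /
        (\<beta> (eps @ replicate m False @ [False]) + \<beta> (eps @ replicate m False @ [True])))
      \<longlonglongrightarrow> 0)"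
proof -
  \<comment> \<open>The means and the partial products differ by the factor
    \<open>mean_path_prob \<beta> eps\<close>, which is positive and independent of
    \<open>n\<close>.\<close>
  have mean_iff: "(\<lambda>n. mean_path_prob \<beta> (eps @ replicate n False)) \<longlonglongrightarrow> 0 \<longleftrightarrow>
      (\<lambda>n. \<Prod>m<n. \<beta> (eps @ replicate m False @ [False]) /
        (\<beta> (eps @ replicate m False @ [False]) + \<beta> (eps @ replicate m False @ [True]))) \<longlonglongrightarrow> 0" for eps
  proof -
    have "mean_path_prob \<beta> eps \<noteq> 0"
      using mean_path_prob_pos[of \<beta> eps] assms by simp
    from tendsto_mult_left_iff[OF this, of _ 0] show ?thesis
      by (simp add: mean_path_prob_zeros)
  qed
  show ?thesis
    unfolding mean_iff[symmetric]
  proof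
    assume "\<exists>!\<mu>. radon_prob tight_topology \<mu> \<and> projects_to_polya \<beta> \<mu>"
    then obtain \<mu> where "radon_prob tight_topology \<mu>" "projects_to_polya \<beta> \<mu>"
      by blast
    then show "\<forall>eps. (\<lambda>n. mean_path_prob \<beta> (eps @ replicate n False)) \<longlonglongrightarrow> 0"
      using projects_imp_mean_tendsto_0[of \<beta> \<mu>] assms unfolding radon_prob_def by blast
  next
    assume "\<forall>eps. (\<lambda>n. mean_path_prob \<beta> (eps @ replicate n False)) \<longlonglongrightarrow> 0"
    then obtain \<mu> where \<mu>: "prob_space \<mu>" "sets \<mu> = sets tight_borel" "projects_to_polya \<beta> \<mu>"
      using polya_tree_law_exists[of \<beta>] assms by blast
    show "\<exists>!\<mu>. radon_prob tight_topology \<mu> \<and> projects_to_polya \<beta> \<mu>"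
    proof (rule ex1I[of _ \<mu>])
      show "radon_prob tight_topology \<mu> \<and> projects_to_polya \<beta> \<mu>"
        using \<mu> by (simp add: radon_prob_tight_topology)
      fix \<nu> assume "radon_prob tight_topology \<nu> \<and> projects_to_polya \<beta> \<nu>"
      \<comment> \<open>Uniqueness holds among all Borel probability measures with these
        projections, in particular among the Radon ones.\<close>
      then show "\<nu> = \<mu>"
        using \<mu> by (intro borel_prob_unique) (simp_all add: radon_prob_def projects_to_polya_def)
    qed
  qed
qed

end
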